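(* For every finite non-empty set $S$, the poset $\Pi^{\mathrm{Perm}}_+(S)^{\mathrm{op}}$ is totally semimodular, and therefore $\Pi^{\mathrm{Perm}}_+(S)$ is Cohen--Macaulay.
   Context: $\Pi^{\mathrm{Perm}}(S)$ is the poset of pointed partitions of $S$: partitions of $S$ in which each block has one distinguished (pointed) element, with $x\le y$ iff the partition of $x$ is obtained by merging blocks of $y$ and the pointed element of each block of $x$ is the pointed element of one of the blocks of $y$ that are merged into it. $\Pi^{\mathrm{Perm}}_+(S)$ is obtained by adding a least element, and $(\cdot)^{\mathrm{op}}$ denotes the poset with reversed order. A finite poset $P$ is totally semimodular if it is bounded and if for any interval $[x,y]$ in $P$ and any distinct $u,v\in[x,y]$ that both cover $x$, there exists $z\in[x,y]$ such that $z$ covers both $u$ and $v$. A graded poset $P$ is Cohen--Macaulay (over a commutative ring $\mathbb{K}$) if for all $x\le y$ in $P$, $h_n([x,y])=0$ for $n$ different from the rank of $[x,y]$, where $h_n([x,y])$ is the $n$-th homology of the complex of chains $x=x_0<x_1<\cdots<x_n=y$ (for $n\ge2$ and $x<y$, equivalently the reduced homology $\widetilde{H}_{n-2}$ of the order complex of the open interval $(x,y)$). *)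

theory Defs
  imports
    "HOL-Library.Disjoint_Sets"
    "HOL-Library.Poly_Mapping"
    "HOL-Algebra.Elementary_Groups"
begin

section \<open>Posets\<close>

text \<open>A poset is a relation \<open>r\<close> with \<^term>\<open>Partial_order r\<close>; its underlying set is
  \<^term>\<open>Field r\<close>, \<open>x \<le> y\<close> is \<open>(x, y) \<in> r\<close>, and the opposite poset is \<open>r\<inverse>\<close>.\<close>

definition poset_interval :: "'p rel \<Rightarrow> 'p \<Rightarrow> 'p \<Rightarrow> 'p set" where
  "poset_interval r x y = {z. (x, z) \<in> r \<and> (z, y) \<in> r}"

definition poset_less :: "'p rel \<Rightarrow> 'p \<Rightarrow> 'p \<Rightarrow> bool" where
  "poset_less r x y \<longleftrightarrow> (x, y) \<in> r \<and> x \<noteq> y"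

text \<open>\<open>covered_by r x y\<close>: the element \<open>y\<close> covers \<open>x\<close>.\<close>

definition covered_by :: "'p rel \<Rightarrow> 'p \<Rightarrow> 'p \<Rightarrow> bool" where
  "covered_by r x y \<longleftrightarrow> poset_less r x y \<and> \<not> (\<exists>z. poset_less r x z \<and> poset_less r z y)"

definition bounded_poset :: "'p rel \<Rightarrow> bool" where
  "bounded_poset r \<longleftrightarrow> Partial_order r \<and>
     (\<exists>b\<in>Field r. \<forall>x\<in>Field r. (b, x) \<in> r) \<and> (\<exists>t\<in>Field r. \<forall>x\<in>Field r. (x, t) \<in> r)"

definition totally_semimodular :: "'p rel \<Rightarrow> bool" where
  "totally_semimodular r \<longleftrightarrow> finite (Field r) \<and> bounded_poset r \<and>
     (\<forall>x y. (x, y) \<in> r \<longrightarrow>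
       (\<forall>u\<in>poset_interval r x y. \<forall>v\<in>poset_interval r x y.
          u \<noteq> v \<and> covered_by r x u \<and> covered_by r x v \<longrightarrow>
            (\<exists>z\<in>poset_interval r x y. covered_by r u z \<and> covered_by r v z)))"

text \<open>The chains \<open>x = x\<^sub>0 < \<dots> < x\<^sub>n = y\<close>, as lists of length \<open>n + 1\<close>.\<close>

definition chains_between :: "'p rel \<Rightarrow> 'p \<Rightarrow> 'p \<Rightarrow> nat \<Rightarrow> 'p list set" where
  "chains_between r x y n =
     {xs. length xs = Suc n \<and> hd xs = x \<and> last xs = y \<and> successively (poset_less r) xs}"

definition maximal_chains :: "'p rel \<Rightarrow> 'p \<Rightarrow> 'p \<Rightarrow> nat \<Rightarrow> 'p list set" where
  "maximal_chains r x y n =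
     {xs. length xs = Suc n \<and> hd xs = x \<and> last xs = y \<and> successively (covered_by r) xs}"

definition graded_poset :: "'p rel \<Rightarrow> bool" where
  "graded_poset r \<longleftrightarrow> finite (Field r) \<and> Partial_order r \<and>
     (\<forall>x y m n. (x, y) \<in> r \<and> maximal_chains r x y m \<noteq> {} \<and> maximal_chains r x y n \<noteq> {}
        \<longrightarrow> m = n)"

text \<open>The rank of \<open>[x, y]\<close> in a graded poset: the common length of its maximal chains.\<close>

definition interval_rank :: "'p rel \<Rightarrow> 'p \<Rightarrow> 'p \<Rightarrow> nat" where
  "interval_rank r x y = (THE n. maximal_chains r x y n \<noteq> {})"


section \<open>Homology of intervals and Cohen--Macaulay posets\<close>

text \<open>The chain module in degree \<open>n\<close> is free on the chains \<open>x = x\<^sub>0 < \<dots> < x\<^sub>n = y\<close>; the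
  boundary of such a chain is \<open>\<Sum>\<close> over \<open>0 < i < n\<close> of \<open>(-1)\<^sup>i\<close> times the chain with \<open>x\<^sub>i\<close>
  omitted. The end points are never omitted.\<close>

definition chain_module :: "'p rel \<Rightarrow> 'p \<Rightarrow> 'p \<Rightarrow> nat \<Rightarrow> ('p list \<Rightarrow>\<^sub>0 'k::comm_ring_1) set" where
  "chain_module r x y n = {c. Poly_Mapping.keys c \<subseteq> chains_between r x y n}"

definition boundary :: "('p list \<Rightarrow>\<^sub>0 'k::comm_ring_1) \<Rightarrow> ('p list \<Rightarrow>\<^sub>0 'k)" where
  "boundary c = (\<Sum>xs\<in>Poly_Mapping.keys c. \<Sum>i\<in>{1..<length xs - 1}.
     Poly_Mapping.single (take i xs @ drop (Suc i) xs) ((-1) ^ i * Poly_Mapping.lookup c xs))"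

definition cycle_group ::
    "'p rel \<Rightarrow> 'p \<Rightarrow> 'p \<Rightarrow> nat \<Rightarrow> ('p list \<Rightarrow>\<^sub>0 'k::comm_ring_1) monoid" where
  "cycle_group r x y n =
     \<lparr>carrier = {c \<in> chain_module r x y n. boundary c = 0}, monoid.mult = (+), one = 0\<rparr>"

definition boundary_set ::
    "'p rel \<Rightarrow> 'p \<Rightarrow> 'p \<Rightarrow> nat \<Rightarrow> ('p list \<Rightarrow>\<^sub>0 'k::comm_ring_1) set" where
  "boundary_set r x y n = boundary ` chain_module r x y (Suc n)"

text \<open>Only the additive group of the homology module is recorded; this is enough to say that
  the module is zero.\<close>

definition interval_homology ::
    "'p rel \<Rightarrow> 'p \<Rightarrow> 'p \<Rightarrow> nat \<Rightarrow> ('p list \<Rightarrow>\<^sub>0 'k::comm_ring_1) set monoid" where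
  "interval_homology r x y n = cycle_group r x y n Mod boundary_set r x y n"

definition cohen_macaulay :: "'k::comm_ring_1 itself \<Rightarrow> 'p rel \<Rightarrow> bool" where
  "cohen_macaulay K r \<longleftrightarrow> graded_poset r \<and>
     (\<forall>x y n. (x, y) \<in> r \<and> n \<noteq> interval_rank r x y \<longrightarrow>
        trivial_group
          (interval_homology r x y n :: ('p list \<Rightarrow>\<^sub>0 'k) set monoid))"


section \<open>Pointed partitions\<close>

text \<open>A pointed partition is the set of its pairs (block, pointed element).\<close>

definition pointed_partitions :: "'a set \<Rightarrow> ('a set \<times> 'a) set set" where
  "pointed_partitions S =
     {X. partition_on S (fst ` X) \<and> inj_on fst X \<and> (\<forall>(B, b)\<in>X. b \<in> B)}"

text \<open>Coarser partitions are smaller, so that \<^term>\<open>refines S (fst ` Y) (fst ` X)\<close> for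
  \<open>X \<le> Y\<close>.\<close>

definition perm_poset :: "'a set \<Rightarrow> ('a set \<times> 'a) set rel" where
  "perm_poset S =
     {(X, Y). X \<in> pointed_partitions S \<and> Y \<in> pointed_partitions S \<and>
        refines S (fst ` Y) (fst ` X) \<and>
        (\<forall>(B, b)\<in>X. \<exists>(C, c)\<in>Y. C \<subseteq> B \<and> b = c)}"

text \<open>\<open>None\<close> is the added least element.\<close>

definition add_least :: "'p rel \<Rightarrow> 'p option rel" where
  "add_least r = {(None, y) | y. y \<in> insert None (Some ` Field r)} \<union> map_prod Some Some ` r"

definition perm_poset_plus :: "'a set \<Rightarrow> ('a set \<times> 'a) set option rel" where
  "perm_poset_plus S = add_least (perm_poset S)"

end

(* A pointed partition of S is the same thing as an idempotent map f on S (send each element to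
   the point of its block), and the order becomes the natural order of idempotents: f <= g iff
   f g = g f = f. Passing to a lower cover removes one point from the image. Given h below two
   distinct lower covers f, g of e, remove from the image of e the points lost in f and in g (if
   both lose the same point a, remove a and one of f a, g a that h does not fix), and send the two
   removed points to survivors that h does not distinguish from them: this is the common lower
   cover.

   Total semimodularity implies Cohen--Macaulayness by an algebraic Mayer--Vietoris argument.
   For a set A of atoms of [x, y], consider the chains x < x_1 < ... < y with x_1 above an element
   of A. Adding an atom a to A adds a cone with apex a, glued along the corresponding complex of
   [a, y] for the atoms covering both a and an element of A; by semimodularity an element above a
   and some b in A is above such an atom. Induction on the rank and on A shows that all these
   complexes are acyclic below the top degree. *)
theory Submission
  imports Defs Complex_Main
begin

section \<open>Linear maps between chain modules\<close>

text \<open>The delicate point of the common lower cover is to stay above h. A removed point may be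
  sent to a survivor exactly when h does not separate the two and does not fix the removed one.
  Since h is below f and g, the points f a and g c always pass the first test; they fail only by
  being removed themselves, and in the worst case, f a = c and g c = a, the point h a serves
  instead. If a = c, the distinct points f a and g a have the same image under h, so h fixes at most
  one of them. The added least element is not a map. Covers are therefore compared through sets of
  points, which is empty for that element, and a constant map takes its place as h whenever f and g
  share a point. The homological argument produces explicit fillings of cycles, valid over every
  commutative ring. Arbitrary sets of atoms are needed because the atoms along which a cone is glued
  cannot be prescribed. The hypothesis concerns the opposite order; reversing chains changes the
  boundary only by a sign depending on the degree, so fillings can be carried back.\<close>

abbreviation keys where "keys \<equiv> Poly_Mapping.keys"
abbreviation lookup where "lookup \<equiv> Poly_Mapping.lookup"
abbreviation single where "single \<equiv> Poly_Mapping.single"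

lemma keys_uminus [simp]: "keys (- c) = keys (c :: 'b \<Rightarrow>\<^sub>0 'k::ab_group_add)"
  by (auto simp: in_keys_iff)

lemma keys_add_subset: "keys c \<subseteq> B \<Longrightarrow> keys d \<subseteq> B \<Longrightarrow> keys (c + d) \<subseteq> B"
  using keys_add[of c d] by blast

lemma keys_minus_subset:
  fixes c d :: "'b \<Rightarrow>\<^sub>0 'k::ab_group_add"
  shows "keys c \<subseteq> B \<Longrightarrow> keys d \<subseteq> B \<Longrightarrow> keys (c - d) \<subseteq> B"
  using keys_add_subset[of c B "- d"] by simp

lemma keys_sum_subset: "keys (sum f X) \<subseteq> (\<Union>x\<in>X. keys (f x))"
proof (induction X rule: infinite_finite_induct)
  case (insert x X)
  then show ?case using keys_add[of "f x" "sum f X"] by auto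
qed auto

lemma sum_singles: "(\<Sum>x\<in>keys c. single x (lookup c x)) = c"
  by (rule poly_mapping_eqI)
    (simp add: lookup_sum lookup_single when_def sum.delta in_keys_iff)

text \<open>Reduces identities between chain maps to a single chain. Asking for agreement only on
  \<open>keys c\<close> lets length conditions on the chains of \<open>c\<close> enter.\<close>

lemma additive_on_singles:
  fixes F G :: "('b \<Rightarrow>\<^sub>0 'k::ab_group_add) \<Rightarrow> ('c \<Rightarrow>\<^sub>0 'l::ab_group_add)"
  assumes "additive F" "additive G"
    and "\<And>x a. x \<in> keys c \<Longrightarrow> F (single x a) = G (single x a)"
  shows "F c = G c"
proof -
  have "F c = F (\<Sum>x\<in>keys c. single x (lookup c x))"
    by (simp add: sum_singles)
  also have "\<dots> = (\<Sum>x\<in>keys c. F (single x (lookup c x)))"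
    using assms(1) by (rule additive.sum)
  also have "\<dots> = (\<Sum>x\<in>keys c. G (single x (lookup c x)))"
    using assms(3) by simp
  also have "\<dots> = G (\<Sum>x\<in>keys c. single x (lookup c x))"
    using assms(2) by (rule additive.sum[symmetric])
  also have "\<dots> = G c"
    by (simp add: sum_singles)
  finally show ?thesis .
qed

text \<open>The range of summation depends on \<open>c\<close>, and keys may cancel in
  \<open>c + d\<close>. As \<open>\<phi> x 0 = 0\<close>, all three sums may be taken over the union
  of both key sets.\<close>

lemma additive_keys_sum:
  fixes \<phi> :: "'b \<Rightarrow> 'k::ab_group_add \<Rightarrow> 'l::ab_group_add"
  assumes add: "\<And>x a b. \<phi> x (a + b) = \<phi> x a + \<phi> x b"
  shows "additive (\<lambda>c :: 'b \<Rightarrow>\<^sub>0 'k. \<Sum>x\<in>keys c. \<phi> x (lookup c x))"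
proof
  fix c d :: "'b \<Rightarrow>\<^sub>0 'k"
  have zero: "\<phi> x 0 = 0" for x
    using add[of x 0 0] by simp
  have ext: "(\<Sum>x\<in>keys e. \<phi> x (lookup e x)) = (\<Sum>x\<in>X. \<phi> x (lookup e x))"
    if "finite X" "keys e \<subseteq> X" for e X
    using that by (intro sum.mono_neutral_left) (auto simp: in_keys_iff zero)
  let ?X = "keys c \<union> keys d"
  have "(\<Sum>x\<in>keys (c + d). \<phi> x (lookup (c + d) x)) = (\<Sum>x\<in>?X. \<phi> x (lookup (c + d) x))"
    by (rule ext) (use keys_add[of c d] in auto)
  also have "\<dots> = (\<Sum>x\<in>?X. \<phi> x (lookup c x)) + (\<Sum>x\<in>?X. \<phi> x (lookup d x))"
    by (simp add: lookup_add add sum.distrib)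
  also have "\<dots> = (\<Sum>x\<in>keys c. \<phi> x (lookup c x)) + (\<Sum>x\<in>keys d. \<phi> x (lookup d x))"
    by (simp add: ext[of ?X c] ext[of ?X d])
  finally show "(\<Sum>x\<in>keys (c + d). \<phi> x (lookup (c + d) x)) =
    (\<Sum>x\<in>keys c. \<phi> x (lookup c x)) + (\<Sum>x\<in>keys d. \<phi> x (lookup d x))" .
qed

text \<open>The linear extension of a map of bases; it is used for prepending or replacing the first
  element of chains, for dropping it, and for reversal.\<close>

definition pushforward :: "('b \<Rightarrow> 'c) \<Rightarrow> ('b \<Rightarrow>\<^sub>0 'k::ab_group_add) \<Rightarrow> ('c \<Rightarrow>\<^sub>0 'k)" where
  "pushforward g c = (\<Sum>x\<in>keys c. single (g x) (lookup c x))"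

lemma additive_pushforward: "additive (pushforward g)"
  unfolding pushforward_def[abs_def] by (rule additive_keys_sum) (simp add: single_add)

lemma pushforward_single [simp]: "pushforward g (single x a) = single (g x) a"
  by (simp add: pushforward_def)

lemma keys_pushforward: "keys (pushforward g c) \<subseteq> g ` keys c"
  unfolding pushforward_def by (rule order.trans[OF keys_sum_subset]) (auto split: if_splits)

lemma keys_pushforward_subset:
  assumes "keys c \<subseteq> A" and "\<And>x. x \<in> A \<Longrightarrow> g x \<in> B"
  shows "keys (pushforward g c) \<subseteq> B"
  using keys_pushforward[of g c] assms by blast

lemma lookup_pushforward:
  assumes "inj_on g (insert x (keys c))"
  shows "lookup (pushforward g c) (g x) = lookup c x"
proof -
  have "lookup (pushforward g c) (g x) = (\<Sum>y\<in>keys c. if y = x then lookup c y else 0)"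
    unfolding pushforward_def lookup_sum lookup_single
    by (rule sum.cong) (use assms in \<open>auto simp: when_def inj_on_def\<close>)
  also have "\<dots> = lookup c x"
    by (simp add: sum.delta in_keys_iff)
  finally show ?thesis .
qed

lemma keys_pushforward_inj:
  assumes "inj_on g (keys c)" and "x \<in> keys c"
  shows "g x \<in> keys (pushforward g c)"
  using assms lookup_pushforward[of g x c] by (auto simp: in_keys_iff insert_absorb)

lemma pushforward_eq_0:
  assumes "inj_on g (keys c)" and "pushforward g c = 0"
  shows "c = 0"
  using keys_pushforward_inj[OF assms(1)] assms(2) by (metis all_not_in_conv keys_eq_empty)

lemma pushforward_pushforward: "pushforward g (pushforward h c) = pushforward (g \<circ> h) c"
proof (rule additive_on_singles[of "\<lambda>c. pushforward g (pushforward h c)"], goal_cases)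
  case 1
  show ?case by standard (simp add: additive.add[OF additive_pushforward])
qed (simp_all add: additive_pushforward)

lemma pushforward_ident:
  assumes "\<And>x. x \<in> keys c \<Longrightarrow> g x = x"
  shows "pushforward g c = c"
proof -
  have "pushforward g c = (\<Sum>x\<in>keys c. single x (lookup c x))"
    unfolding pushforward_def using assms by simp
  then show ?thesis by (simp add: sum_singles)
qed

definition restrict_keys :: "('b \<Rightarrow> bool) \<Rightarrow> ('b \<Rightarrow>\<^sub>0 'k::ab_group_add) \<Rightarrow> ('b \<Rightarrow>\<^sub>0 'k)" where
  "restrict_keys P c = (\<Sum>x\<in>{x \<in> keys c. P x}. single x (lookup c x))"

lemma keys_restrict_keys: "keys (restrict_keys P c) \<subseteq> {x \<in> keys c. P x}"
  unfolding restrict_keys_def by (rule order.trans[OF keys_sum_subset]) (auto split: if_splits)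

lemma keys_restrict_keys_subset:
  assumes "keys c \<subseteq> A" and "\<And>x. x \<in> A \<Longrightarrow> P x \<Longrightarrow> x \<in> B"
  shows "keys (restrict_keys P c) \<subseteq> B"
  using keys_restrict_keys[of P c] assms by blast

lemma restrict_keys_add: "restrict_keys P c + restrict_keys (\<lambda>x. \<not> P x) c = c"
proof -
  have "restrict_keys P c + restrict_keys (\<lambda>x. \<not> P x) c =
    (\<Sum>x\<in>{x \<in> keys c. P x} \<union> {x \<in> keys c. \<not> P x}. single x (lookup c x))"
    unfolding restrict_keys_def by (rule sum.union_disjoint[symmetric]) auto
  also have "{x \<in> keys c. P x} \<union> {x \<in> keys c. \<not> P x} = keys c" by auto
  finally show ?thesis by (simp add: sum_singles)
qed

section \<open>The boundary of cones, of chains with a new first element, and of reversed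
  chains\<close>

lemma additive_boundary: "additive (boundary :: ('p list \<Rightarrow>\<^sub>0 'k::comm_ring_1) \<Rightarrow> _)"
  unfolding boundary_def[abs_def]
  by (rule additive_keys_sum) (simp add: single_add distrib_left sum.distrib)

lemmas boundary_0 = additive.zero[OF additive_boundary]
  and boundary_add = additive.add[OF additive_boundary]
  and boundary_minus = additive.minus[OF additive_boundary]
  and boundary_diff = additive.diff[OF additive_boundary]
  and pushforward_0 = additive.zero[OF additive_pushforward]
  and pushforward_add = additive.add[OF additive_pushforward]
  and pushforward_diff = additive.diff[OF additive_pushforward]
  and pushforward_sum = additive.sum[OF additive_pushforward]

lemma boundary_single:
  "boundary (single xs a) = (\<Sum>i\<in>{1..<length xs - 1}.
     single (take i xs @ drop (Suc i) xs) ((-1) ^ i * (a :: 'k::comm_ring_1)))"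
  by (cases "a = 0") (simp_all add: boundary_def)

lemma keys_boundary:
  assumes "ys \<in> keys (boundary c)"
  obtains xs i where "xs \<in> keys c" "1 \<le> i" "i < length xs - 1" "ys = take i xs @ drop (Suc i) xs"
proof -
  have "keys (boundary c) \<subseteq> (\<Union>xs\<in>keys c. \<Union>i\<in>{1..<length xs - 1}.
     keys (single (take i xs @ drop (Suc i) xs) ((-1) ^ i * lookup c xs)))"
    unfolding boundary_def
    by (intro order.trans[OF keys_sum_subset] UN_mono order_refl keys_sum_subset)
  with assms that show ?thesis by (fastforce split: if_splits)
qed

text \<open>End points are not vertices of the order complex. Putting x in front of chains that
  start at a turns a into a vertex, so this is the cone with apex a.\<close>

abbreviation cone :: "'p \<Rightarrow> ('p list \<Rightarrow>\<^sub>0 'k::comm_ring_1) \<Rightarrow> ('p list \<Rightarrow>\<^sub>0 'k)" where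
  "cone x \<equiv> pushforward (Cons x)"

abbreviation rehead :: "'p \<Rightarrow> ('p list \<Rightarrow>\<^sub>0 'k::comm_ring_1) \<Rightarrow> ('p list \<Rightarrow>\<^sub>0 'k)" where
  "rehead x \<equiv> pushforward (\<lambda>xs. x # tl xs)"

lemma boundary_rehead: "boundary (rehead x c) = rehead x (boundary c)"
proof (rule additive_on_singles[of "\<lambda>c. boundary (rehead x c)" "\<lambda>c. rehead x (boundary c)"], goal_cases)
  case (3 xs a)
  show ?case
    by (cases xs)
      (auto simp: boundary_single pushforward_sum pushforward_0 Suc_le_eq gr0_conv_Suc
        intro!: sum.cong)
qed (auto simp: additive_def boundary_add pushforward_add)

text \<open>Omitting position 1 of \<open>x # xs\<close> removes the old head, which gives the
  reheaded chain with sign -1; every other omission is one in \<open>xs\<close> with its index,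
  hence its sign, shifted. For a one-element \<open>xs\<close> the old head is the last entry and is
  never omitted, hence the bound on the length.\<close>

lemma boundary_cone:
  assumes "\<And>xs. xs \<in> keys c \<Longrightarrow> 2 \<le> length xs"
  shows "boundary (cone x c) = - rehead x c - cone x (boundary c)"
proof (rule additive_on_singles[of "\<lambda>c. boundary (cone x c)"], goal_cases)
  case (3 xs a)
  then have len: "2 \<le> length xs" by (rule assms)
  have "boundary (cone x (single xs a)) = (\<Sum>i\<in>{1..<length xs}.
      single (take i (x # xs) @ drop (Suc i) (x # xs)) ((-1) ^ i * a))"
    by (simp add: boundary_single)
  also have "{1..<length xs} = insert 1 (Suc ` {1..<length xs - 1})"
  proof -
    have "{1..<length xs} = insert 1 {Suc 1..<Suc (length xs - 1)}" using len by auto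
    then show ?thesis by (simp only: image_Suc_atLeastLessThan)
  qed
  also have "(\<Sum>i\<in>insert 1 (Suc ` {1..<length xs - 1}). single (take i (x # xs) @ drop (Suc i) (x # xs)) ((-1) ^ i * a)) =
      single (x # tl xs) (- a) +
      (\<Sum>i\<in>{1..<length xs - 1}. single (x # (take i xs @ drop (Suc i) xs)) (- ((-1) ^ i * a)))"
    by (simp add: sum.reindex image_iff drop_Suc single_uminus del: image_Suc_atLeastLessThan) 
  also have "\<dots> = - rehead x (single xs a) - cone x (boundary (single xs a))"
    by (simp add: boundary_single pushforward_sum single_uminus sum_negf)
  finally show ?case .
qed (auto simp: additive_def boundary_add pushforward_add)

text \<open>Induction along the chain by the cone formula: the two reheaded boundaries cancel, and
  what remains is the cone over the double boundary of the tail.\<close>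

lemma boundary_boundary: "boundary (boundary c) = 0"
proof (rule additive_on_singles[of "\<lambda>c. boundary (boundary c)" "\<lambda>_. 0"], goal_cases)
  case (3 xs a)
  show ?case
  proof (induction xs)
    case Nil
    show ?case by (simp add: boundary_single boundary_0)
  next
    case (Cons x xs)
    consider "length xs < 2" | "length xs = 2" | "length xs > 2" by linarith
    then show ?case
    proof cases
      case 1
      then show ?thesis by (simp add: boundary_single boundary_0)
    next
      case 2
      then have "{1..<length (x # xs) - 1} = {1}" by auto
      then show ?thesis using 2 by (simp add: boundary_single)
    next
      case 3
      have bd: "boundary (single (x # xs) a) =
          - rehead x (single xs a) - cone x (boundary (single xs a))"
        using 3 by (subst pushforward_single[symmetric], subst boundary_cone) (auto split: if_splits)
      have "boundary (cone x (boundary (single xs a))) =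
          - rehead x (boundary (single xs a)) - cone x (boundary (boundary (single xs a)))"
      proof (rule boundary_cone)
        fix ys assume "ys \<in> keys (boundary (single xs a))"
        then show "2 \<le> length ys" by (rule keys_boundary) (use 3 in \<open>auto split: if_splits\<close>)
      qed
      then show ?thesis
        unfolding bd boundary_diff boundary_minus boundary_rehead Cons.IH
        by (simp add: pushforward_0)
    qed
  qed
qed (auto simp: additive_def boundary_add)

text \<open>Omitting entry i of the reversed chain is omitting entry n - i of the original, and the
  two signs differ by the factor \<open>(-1) ^ n\<close>, here written as \<open>id\<close> or
  \<open>uminus\<close>.\<close>

lemma boundary_rev:
  assumes "\<And>xs. xs \<in> keys c \<Longrightarrow> length xs = Suc n"
  shows "boundary (pushforward rev c) = (if even n then id else uminus) (pushforward rev (boundary c))"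
proof (rule additive_on_singles[of "\<lambda>c. boundary (pushforward rev c)"
      "\<lambda>c. (if even n then id else uminus) (pushforward rev (boundary c))"], goal_cases)
  case (3 xs a)
  then have len: "length xs = Suc n" by (rule assms)
  have "boundary (pushforward rev (single xs a)) = (\<Sum>i\<in>{1..<n}.
      single (take i (rev xs) @ drop (Suc i) (rev xs)) ((-1) ^ i * a))"
    by (simp add: boundary_single len)
  also have "\<dots> = (\<Sum>i\<in>{1..<n}. (if even n then id else uminus)
      (single (rev (take i xs @ drop (Suc i) xs)) ((-1) ^ i * a)))"
  proof (rule sum.reindex_bij_witness[of _ "\<lambda>i. n - i" "\<lambda>i. n - i"])
    fix i assume i: "i \<in> {1..<n}"
    have parity: "(-1) ^ (n - i) = (if even n then 1 else - 1) * ((-1) ^ i :: 'b)"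
      using i by (auto simp: minus_one_power_iff)
    have "rev (take (n - i) xs @ drop (Suc (n - i)) xs) = take i (rev xs) @ drop (Suc i) (rev xs)"
      using i len by (simp add: rev_drop rev_take Suc_diff_le)
    with i parity show "(if even n then id else uminus)
        (single (rev (take (n - i) xs @ drop (Suc (n - i)) xs)) ((-1) ^ (n - i) * a)) =
      single (take i (rev xs) @ drop (Suc i) (rev xs)) ((-1) ^ i * a)"
      by (simp add: single_uminus)
  qed auto
  also have "\<dots> = (if even n then id else uminus) (pushforward rev (boundary (single xs a)))"
    by (simp add: boundary_single len pushforward_sum sum_negf)
  finally show ?case .
qed (auto simp: additive_def boundary_add pushforward_add)

section \<open>Chains in totally semimodular posets\<close>

lemma poset_trans: "Partial_order r \<Longrightarrow> (x, y) \<in> r \<Longrightarrow> (y, z) \<in> r \<Longrightarrow> (x, z) \<in> r"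
  unfolding partial_order_on_def preorder_on_def by (meson transD)

lemma poset_less_trans:
  assumes "Partial_order r" "poset_less r x y" "poset_less r y z"
  shows "poset_less r x z"
  using assms unfolding poset_less_def partial_order_on_def preorder_on_def
  by (metis antisymD transD)

lemma poset_less_le_trans:
  assumes "Partial_order r" "poset_less r x y" "(y, z) \<in> r"
  shows "poset_less r x z"
  using assms unfolding poset_less_def partial_order_on_def preorder_on_def
  by (metis antisymD transD)

lemma covered_by_imp_less: "covered_by r x y \<Longrightarrow> poset_less r x y"
  by (simp add: covered_by_def)

lemma obtain_cover:
  assumes fin: "finite (Field r)" and po: "Partial_order r" and less: "poset_less r x y"
  obtains u where "covered_by r x u" "(u, y) \<in> r"
proof -
  have "\<exists>u. covered_by r x u \<and> (u, y) \<in> r"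
    using less
  proof (induction "card {z. poset_less r x z \<and> poset_less r z y}" arbitrary: y rule: less_induct)
    case less
    have y: "(y, y) \<in> r"
      using less.prems po unfolding poset_less_def partial_order_on_def preorder_on_def refl_on_def
      by (auto simp: Field_def)
    show ?case
    proof (cases "covered_by r x y")
      case False
      with less.prems obtain w where w: "poset_less r x w" "poset_less r w y"
        by (auto simp: covered_by_def)
      have "{z. poset_less r x z \<and> poset_less r z w} \<subset> {z. poset_less r x z \<and> poset_less r z y}"
      proof
        show "{z. poset_less r x z \<and> poset_less r z w} \<subseteq> {z. poset_less r x z \<and> poset_less r z y}"
          using w(2) poset_less_trans[OF po] by blast
        show "{z. poset_less r x z \<and> poset_less r z w} \<noteq> {z. poset_less r x z \<and> poset_less r z y}"
          using w by (auto simp: poset_less_def)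
      qed
      moreover have "finite {z. poset_less r x z \<and> poset_less r z y}"
        by (rule finite_subset[OF _ fin]) (auto simp: poset_less_def Field_def)
      ultimately have "\<exists>u. covered_by r x u \<and> (u, w) \<in> r"
        using less.hyps w(1) by (simp add: psubset_card_mono)
      with w(2) show ?thesis
        using poset_trans[OF po] unfolding poset_less_def by blast
    qed (use y in blast)
  qed
  with that show ?thesis by blast
qed

lemma chains_between_0: "chains_between r x y 0 = (if x = y then {[x]} else {})"
  by (auto simp: chains_between_def length_Suc_conv)

lemma chains_between_Suc:
  "xs \<in> chains_between r x y (Suc n) \<longleftrightarrow>
    (\<exists>w ws. xs = x # w # ws \<and> poset_less r x w \<and> w # ws \<in> chains_between r w y n)"
  by (cases xs; cases "tl xs") (auto simp: chains_between_def)

lemma chains_between_ConsD: "xs \<in> chains_between r x y n \<Longrightarrow> \<exists>ws. xs = x # ws"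
  by (cases xs) (auto simp: chains_between_def)

lemma maximal_chains_0: "maximal_chains r x y 0 = (if x = y then {[x]} else {})"
  by (auto simp: maximal_chains_def length_Suc_conv)

lemma maximal_chains_Suc:
  "xs \<in> maximal_chains r x y (Suc n) \<longleftrightarrow>
    (\<exists>w ws. xs = x # w # ws \<and> covered_by r x w \<and> w # ws \<in> maximal_chains r w y n)"
  by (cases xs; cases "tl xs") (auto simp: maximal_chains_def)

lemma maximal_chains_Suc_nonempty:
  "maximal_chains r x y (Suc n) \<noteq> {} \<longleftrightarrow>
    (\<exists>w. covered_by r x w \<and> maximal_chains r w y n \<noteq> {})"
proof
  assume "\<exists>w. covered_by r x w \<and> maximal_chains r w y n \<noteq> {}"
  then obtain w xs where "covered_by r x w" "xs \<in> maximal_chains r w y n" by blast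
  moreover from this(2) have "w # tl xs \<in> maximal_chains r w y n"
    by (cases xs) (auto simp: maximal_chains_def)
  ultimately have "x # w # tl xs \<in> maximal_chains r x y (Suc n)"
    unfolding maximal_chains_Suc by blast
  then show "maximal_chains r x y (Suc n) \<noteq> {}" by blast
next
  assume "maximal_chains r x y (Suc n) \<noteq> {}"
  then obtain xs where "xs \<in> maximal_chains r x y (Suc n)" by blast
  then show "\<exists>w. covered_by r x w \<and> maximal_chains r w y n \<noteq> {}"
    unfolding maximal_chains_Suc by blast
qed

lemma chains_between_le:
  assumes "Partial_order r" "y \<in> Field r" "xs \<in> chains_between r x y n"
  shows "(x, y) \<in> r"
  using assms(3)
proof (induction n arbitrary: x xs)
  case 0
  then show ?case
    using assms(1,2) by (auto simp: chains_between_0 partial_order_on_def preorder_on_def refl_on_def split: if_splits)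
next
  case (Suc n)
  then show ?case
    using assms(1) unfolding chains_between_Suc poset_less_def partial_order_on_def preorder_on_def
    by (meson transD)
qed

lemma maximal_chains_le:
  assumes "Partial_order r" "y \<in> Field r" "maximal_chains r x y n \<noteq> {}"
  shows "(x, y) \<in> r"
proof -
  have "maximal_chains r x y n \<subseteq> chains_between r x y n"
    unfolding maximal_chains_def chains_between_def
    by (auto elim: successively_mono dest: covered_by_imp_less)
  with assms(3) obtain xs where "xs \<in> chains_between r x y n" by blast
  then show ?thesis by (rule chains_between_le[OF assms(1,2)])
qed

lemma maximal_chain_exists:
  assumes fin: "finite (Field r)" and po: "Partial_order r" and "(x, y) \<in> r"
  obtains n where "maximal_chains r x y n \<noteq> {}"
proof -
  have "\<exists>n. maximal_chains r x y n \<noteq> {}"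
    using \<open>(x, y) \<in> r\<close>
  proof (induction "card {z. poset_less r x z \<and> (z, y) \<in> r}" arbitrary: x rule: less_induct)
    case less
    show ?case
    proof (cases "x = y")
      case True
      then have "maximal_chains r x y 0 \<noteq> {}" by (simp add: maximal_chains_0)
      then show ?thesis ..
    next
      case False
      with less.prems have "poset_less r x y" by (simp add: poset_less_def)
      then obtain u where u: "covered_by r x u" "(u, y) \<in> r"
        using obtain_cover[OF fin po] by blast
      have xu: "poset_less r x u" using u(1) by (rule covered_by_imp_less)
      have "{z. poset_less r u z \<and> (z, y) \<in> r} \<subset> {z. poset_less r x z \<and> (z, y) \<in> r}"
      proof
        show "{z. poset_less r u z \<and> (z, y) \<in> r} \<subseteq> {z. poset_less r x z \<and> (z, y) \<in> r}"
          using xu poset_less_trans[OF po] by blast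
        show "{z. poset_less r u z \<and> (z, y) \<in> r} \<noteq> {z. poset_less r x z \<and> (z, y) \<in> r}"
          using xu u(2) by (auto simp: poset_less_def)
      qed
      moreover have "finite {z. poset_less r x z \<and> (z, y) \<in> r}"
        by (rule finite_subset[OF _ fin]) (auto simp: poset_less_def Field_def)
      ultimately obtain n where "maximal_chains r u y n \<noteq> {}"
        using less.hyps u(2) by (meson psubset_card_mono)
      with u(1) maximal_chains_Suc_nonempty show ?thesis by metis
    qed
  qed
  with that show ?thesis by blast
qed

lemma totally_semimodularD:
  assumes "totally_semimodular r"
  shows "finite (Field r)" "Partial_order r"
    and "\<lbrakk>covered_by r x u; covered_by r x v; u \<noteq> v; (u, y) \<in> r; (v, y) \<in> r\<rbrakk> \<Longrightarrow>
      \<exists>z. covered_by r u z \<and> covered_by r v z \<and> (z, y) \<in> r"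
proof -
  show fin: "finite (Field r)" and po: "Partial_order r"
    using assms by (auto simp: totally_semimodular_def bounded_poset_def)
  assume c: "covered_by r x u" "covered_by r x v" "u \<noteq> v" "(u, y) \<in> r" "(v, y) \<in> r"
  then have "(x, y) \<in> r"
    using po unfolding covered_by_def poset_less_def partial_order_on_def preorder_on_def
    by (meson transD)
  moreover have "u \<in> poset_interval r x y" "v \<in> poset_interval r x y"
    using c by (auto simp: poset_interval_def covered_by_def poset_less_def)
  ultimately have "\<exists>z\<in>poset_interval r x y. covered_by r u z \<and> covered_by r v z"
    using assms c(1-3) unfolding totally_semimodular_def by blast
  then show "\<exists>z. covered_by r u z \<and> covered_by r v z \<and> (z, y) \<in> r"
    by (auto simp: poset_interval_def)
qed

text \<open>The Jordan-Dedekind argument: if the chains start with different atoms u and v, a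
  maximal chain from a common cover z to y prolongs downwards to both u and v and ties the two
  lengths together.\<close>

lemma maximal_chain_lengths_eq:
  assumes tsm: "totally_semimodular r" and y: "y \<in> Field r"
    and "maximal_chains r x y m \<noteq> {}" "maximal_chains r x y n \<noteq> {}"
  shows "m = n"
  using assms(3,4)
proof (induction m arbitrary: x n)
  case 0
  then have "x = y" by (simp add: maximal_chains_0 split: if_splits)
  show ?case
  proof (cases n)
    case (Suc k)
    with 0 obtain w where w: "covered_by r x w" "maximal_chains r w y k \<noteq> {}"
      using maximal_chains_Suc_nonempty by metis
    then have "poset_less r x w" "(w, y) \<in> r"
      using maximal_chains_le[OF totally_semimodularD(2)[OF tsm] y] covered_by_imp_less by fast+
    with \<open>x = y\<close> have "poset_less r x x"
      using poset_less_le_trans[OF totally_semimodularD(2)[OF tsm]] by blast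
    then show ?thesis by (simp add: poset_less_def)
  qed simp
next
  case (Suc m)
  note po = totally_semimodularD(2)[OF tsm] and fin = totally_semimodularD(1)[OF tsm]
  from Suc.prems(1) obtain u where u: "covered_by r x u" "maximal_chains r u y m \<noteq> {}"
    unfolding maximal_chains_Suc_nonempty by blast
  have uy: "(u, y) \<in> r" using maximal_chains_le[OF po y u(2)] .
  have "n \<noteq> 0"
  proof
    assume "n = 0"
    with Suc.prems(2) have "x = y" by (simp add: maximal_chains_0 split: if_splits)
    with u uy covered_by_imp_less poset_less_le_trans[OF po] have "poset_less r x x" by metis
    then show False by (simp add: poset_less_def)
  qed
  then obtain k where k: "n = Suc k" by (cases n) auto
  with Suc.prems(2) obtain v where v: "covered_by r x v" "maximal_chains r v y k \<noteq> {}"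
    using maximal_chains_Suc_nonempty by metis
  show ?case
  proof (cases "u = v")
    case True
    with Suc.IH[OF u(2)] v(2) k show ?thesis by simp
  next
    case False
    obtain z where z: "covered_by r u z" "covered_by r v z" "(z, y) \<in> r"
      using totally_semimodularD(3)[OF tsm u(1) v(1) False uy maximal_chains_le[OF po y v(2)]] by blast
    obtain l where l: "maximal_chains r z y l \<noteq> {}"
      using maximal_chain_exists[OF fin po z(3)] .
    have "maximal_chains r u y (Suc l) \<noteq> {}" "maximal_chains r v y (Suc l) \<noteq> {}"
      using z l maximal_chains_Suc_nonempty by metis+
    \<comment> \<open>The chain through z has the length m of the given chain from u, so v also has
      a maximal chain of length m, and the induction hypothesis applies at v.\<close>
    then have "m = Suc l" "maximal_chains r v y m \<noteq> {}"
      using Suc.IH[OF u(2)] by auto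
    with Suc.IH v(2) k show ?thesis by blast
  qed
qed

lemma graded_poset_totally_semimodular:
  assumes "totally_semimodular r"
  shows "graded_poset r"
  unfolding graded_poset_def
proof (intro conjI allI impI)
  fix x y m n
  assume *: "(x, y) \<in> r \<and> maximal_chains r x y m \<noteq> {} \<and> maximal_chains r x y n \<noteq> {}"
  then have "y \<in> Field r" by (auto simp: Field_def)
  then show "m = n" using maximal_chain_lengths_eq[OF assms, of y x m n] * by simp
qed (rule totally_semimodularD[OF assms])+

text \<open>For an up-set U this is a subcomplex: with the second element in U, all later ones are
  in U. It computes the reduced homology of the part of the open interval that lies in U; the chain
  \<open>[x, y]\<close> stands for the empty simplex.\<close>

definition chains_via :: "'p rel \<Rightarrow> 'p \<Rightarrow> 'p \<Rightarrow> 'p set \<Rightarrow> nat \<Rightarrow> 'p list set" where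
  "chains_via r x y U n = {xs \<in> chains_between r x y n. \<exists>w ws. xs = x # w # ws \<and> w \<in> U}"

lemma chains_via_Suc:
  "xs \<in> chains_via r x y U (Suc n) \<longleftrightarrow>
    (\<exists>w ws. xs = x # w # ws \<and> poset_less r x w \<and> w \<in> U \<and> w # ws \<in> chains_between r w y n)"
  by (auto simp: chains_via_def chains_between_Suc)

lemma chains_via_0 [simp]: "chains_via r x y U 0 = {}"
  by (auto simp: chains_via_def chains_between_0 split: if_splits)

lemma chains_via_mono: "U \<subseteq> V \<Longrightarrow> chains_via r x y U n \<subseteq> chains_via r x y V n"
  unfolding chains_via_def by blast

lemma chains_between_delete:
  assumes "Partial_order r" "xs \<in> chains_between r x y (Suc n)" "1 \<le> i" "i < length xs - 1"
  shows "take i xs @ drop (Suc i) xs \<in> chains_between r x y n"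
proof -
  let ?ys = "take i xs @ drop (Suc i) xs"
  \<comment> \<open>By transitivity all pairs of entries are comparable, not only neighbours, and
    this survives the deletion of an entry.\<close>
  have trans: "transp (poset_less r)"
    using poset_less_trans[OF assms(1)] by (rule transpI)
  have xs: "length xs = Suc (Suc n)" "hd xs = x" "last xs = y" "sorted_wrt (poset_less r) xs"
    using assms(2) by (auto simp: chains_between_def successively_conv_sorted_wrt[OF trans])
  have "xs = take i xs @ xs ! i # drop (Suc i) xs"
    using assms(4) by (simp add: id_take_nth_drop)
  then have "sorted_wrt (poset_less r) (take i xs @ xs ! i # drop (Suc i) xs)"
    using xs(4) by simp
  then have "successively (poset_less r) ?ys"
    by (auto simp: successively_conv_sorted_wrt[OF trans] sorted_wrt_append)
  moreover have "hd ?ys = x" "last ?ys = y" "length ?ys = Suc n"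
    using xs assms(3,4) by (auto simp: hd_append last_append)
  ultimately show ?thesis by (simp add: chains_between_def)
qed

lemma keys_boundary_chains_between:
  assumes "Partial_order r" "keys c \<subseteq> chains_between r x y (Suc n)"
  shows "keys (boundary c) \<subseteq> chains_between r x y n"
proof
  fix ys assume "ys \<in> keys (boundary c)"
  then obtain xs i where "xs \<in> keys c" "1 \<le> i" "i < length xs - 1"
    "ys = take i xs @ drop (Suc i) xs"
    by (rule keys_boundary)
  with assms(2) chains_between_delete[OF assms(1)] show "ys \<in> chains_between r x y n" by blast
qed

text \<open>Only the omission of position 1 changes the second element, and it replaces it by a
  larger one.\<close>

lemma keys_boundary_chains_via:
  assumes po: "Partial_order r" and up: "r `` U \<subseteq> U"
    and c: "keys c \<subseteq> chains_via r x y U (Suc n)"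
  shows "keys (boundary c) \<subseteq> chains_via r x y U n"
proof
  fix ys assume "ys \<in> keys (boundary c)"
  then obtain xs i where xs: "xs \<in> keys c" and i: "1 \<le> i" "i < length xs - 1"
    and ys: "ys = take i xs @ drop (Suc i) xs"
    by (rule keys_boundary)
  from xs c have "xs \<in> chains_via r x y U (Suc n)" by blast
  then obtain w ws where w: "xs = x # w # ws" "w \<in> U" "w # ws \<in> chains_between r w y n"
    and chain: "xs \<in> chains_between r x y (Suc n)"
    by (auto simp: chains_via_Suc chains_between_Suc)
  have "ys \<in> chains_between r x y n"
    using chains_between_delete[OF po chain i] ys by simp
  moreover have "\<exists>v vs. ys = x # v # vs \<and> v \<in> U"
  proof (cases "i = 1")
    case True
    with i w(1) obtain v vs where v: "ws = v # vs" by (cases ws) auto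
    with w(3) have "(w, v) \<in> r"
      by (auto simp: chains_between_def poset_less_def)
    with up w(2) v ys w(1) True show ?thesis by auto
  next
    case False
    with i obtain j where "i = Suc (Suc j)" by (cases i; cases "i - 1") auto
    with ys w show ?thesis by simp
  qed
  ultimately show "ys \<in> chains_via r x y U n" by (simp add: chains_via_def)
qed

section \<open>Acyclicity\<close>

text \<open>The connecting map of Mayer-Vietoris. In the boundary of \<open>c + cone x e\<close>,
  chains with second element a come only from the cone over \<open>boundary e\<close>: those of
  \<open>boundary c\<close> have it in U, and those of \<open>rehead x e\<close> have it strictly
  above a. So this cone vanishes on its own, and the rest says that the reheaded \<open>e\<close> is
  a boundary in the complex of U.\<close>

lemma cone_rehead_cycle:
  fixes c e :: "'p list \<Rightarrow>\<^sub>0 'k::comm_ring_1"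
  assumes po: "Partial_order r" and up: "r `` U \<subseteq> U"
    and a: "a \<notin> U" "poset_less r x a"
    and c: "keys c \<subseteq> chains_via r x y U (Suc (Suc n))"
    and e: "keys e \<subseteq> chains_between r a y (Suc n)"
    and cycle: "boundary (c + cone x e) = 0"
  shows "boundary e = 0" and "rehead x e = boundary c"
proof -
  have len: "2 \<le> length xs" if "xs \<in> keys e" for xs
    using that e by (auto simp: chains_between_def)
  have eq: "cone x (boundary e) = boundary c - rehead x e"
    using cycle by (simp add: boundary_add boundary_cone[OF len] algebra_simps)
  have "keys (boundary e) \<subseteq> chains_between r a y n"
    by (rule keys_boundary_chains_between[OF po e])
  then have "keys (cone x (boundary e)) \<subseteq> {xs. xs ! 1 = a}"
    by (rule keys_pushforward_subset) (auto dest: chains_between_ConsD)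
  moreover have "keys (boundary c - rehead x e) \<subseteq> {xs. xs ! 1 \<noteq> a}"
  proof -
    have "keys (boundary c) \<subseteq> chains_via r x y U (Suc n)"
      by (rule keys_boundary_chains_via[OF po up c])
    then have "keys (boundary c) \<subseteq> {xs. xs ! 1 \<noteq> a}"
      using a(1) by (rule_tac order.trans) (auto simp: chains_via_def)
    moreover have "keys (rehead x e) \<subseteq> {xs. xs ! 1 \<noteq> a}"
      by (rule keys_pushforward_subset[OF e]) (auto simp: chains_between_Suc poset_less_def)
    ultimately show ?thesis
      by (rule keys_minus_subset)
  qed
  ultimately have "keys (cone x (boundary e)) = {}"
    unfolding eq by blast
  then have zero: "cone x (boundary e) = 0" by simp
  then show "boundary e = 0" by (rule pushforward_eq_0[rotated]) simp
  show "rehead x e = boundary c" using eq zero by simp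
qed

text \<open>Outer induction on the rank, inner induction on the set of atoms. Up to a boundary,
  \<open>c\<close> is \<open>c1 + cone x e\<close> with \<open>e\<close> a cycle of [a, y] in the
  complex of \<open>A'\<close>. A filling \<open>f\<close> of \<open>e\<close>, from the outer
  induction with rank and degree both lowered by one, trades the cone for a chain in the complex of
  A, where the inner induction fills what is left.\<close>

lemma acyclic_chains_via:
  fixes c :: "'p list \<Rightarrow>\<^sub>0 'k::comm_ring_1"
  assumes tsm: "totally_semimodular r" and y: "y \<in> Field r"
    and "maximal_chains r x y m \<noteq> {}" "n < m"
    and "A \<subseteq> {a. covered_by r x a \<and> (a, y) \<in> r}"
    and "keys c \<subseteq> chains_via r x y (r `` A) n" "boundary c = 0"
  shows "\<exists>d. keys d \<subseteq> chains_via r x y (r `` A) (Suc n) \<and> boundary d = c"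
  using assms(3-)
proof (induction m arbitrary: x n A c)
  case (Suc m)
  note fin = totally_semimodularD(1)[OF tsm] and po = totally_semimodularD(2)[OF tsm]
  have trans: "(u, w) \<in> r" if "(u, v) \<in> r" "(v, w) \<in> r" for u v w
    using poset_trans[OF po that] .
  have refl: "(u, u) \<in> r" if "u \<in> Field r" for u
    using po that by (auto simp: partial_order_on_def preorder_on_def refl_on_def)
  have up: "r `` (r `` B) \<subseteq> r `` B" for B
    using trans by blast
  have "finite A"
    by (rule finite_subset[OF _ fin]) (use Suc.prems(3) in \<open>auto simp: Field_def\<close>)
  then show ?case
    using Suc.prems(3-5)
  proof (induction A arbitrary: c)
    case empty
    then have "c = 0" by (auto simp: chains_via_def)
    then show ?case by (intro exI[of _ 0]) (simp add: boundary_0)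
  next
    case (insert a A)
    show ?case
    proof (cases n)
      case 0
      with insert.prems have "c = 0" by simp
      then show ?thesis by (intro exI[of _ 0]) (simp add: boundary_0)
    next
      case (Suc n')
      have a: "covered_by r x a" "(a, y) \<in> r" and A: "\<And>b. b \<in> A \<Longrightarrow> covered_by r x b \<and> (b, y) \<in> r"
        using insert.prems(1) by auto
      have xa: "poset_less r x a" using a(1) by (rule covered_by_imp_less)
      have aF: "a \<in> Field r" using a(2) by (auto simp: Field_def)
      \<comment> \<open>Distinct atoms are incomparable.\<close>
      have aA: "a \<notin> r `` A"
        using insert.hyps(2) a(1) A by (auto simp: covered_by_def poset_less_def)
      obtain l where l: "maximal_chains r a y l \<noteq> {}"
        using maximal_chain_exists[OF fin po a(2)] .
      then have "maximal_chains r x y (Suc l) \<noteq> {}"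
        using a(1) maximal_chains_Suc_nonempty by metis
      then have "Suc l = Suc m"
        using maximal_chain_lengths_eq[OF tsm y _ Suc.prems(1)] by blast
      with l have max_a: "maximal_chains r a y m \<noteq> {}" by simp
      \<comment> \<open>This is where being below the top degree matters at the bottom: for
        \<open>n' = 0\<close> the chain \<open>[a]\<close> would otherwise be a cycle without a
        filling.\<close>
      have "a \<noteq> y"
      proof
        assume "a = y"
        then have "maximal_chains r a y 0 \<noteq> {}" by (simp add: maximal_chains_0)
        with max_a have "m = 0" using maximal_chain_lengths_eq[OF tsm y] by blast
        with Suc.prems(2) Suc show False by simp
      qed

      \<comment> \<open>\<open>c1\<close> lies in the complex for \<open>A\<close>, \<open>c3\<close> passes through \<open>a\<close>; the rest \<open>c2\<close> lies strictly
        above \<open>a\<close>, and inserting \<open>a\<close> makes it homologous to chains through \<open>a\<close>.\<close>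
      let ?inA = "\<lambda>xs. xs ! 1 \<in> r `` A" and ?at = "\<lambda>xs. xs ! 1 = a"
      define c1 where "c1 = restrict_keys ?inA c"
      define c2 where "c2 = restrict_keys (\<lambda>xs. \<not> ?at xs) (restrict_keys (\<lambda>xs. \<not> ?inA xs) c)"
      define c3 where "c3 = restrict_keys ?at (restrict_keys (\<lambda>xs. \<not> ?inA xs) c)"
      have c_split: "c = c1 + (c3 + c2)"
        unfolding c1_def c2_def c3_def by (simp add: restrict_keys_add)
      have c1: "keys c1 \<subseteq> chains_via r x y (r `` A) n"
        unfolding c1_def by (rule keys_restrict_keys_subset[OF insert.prems(2)])
          (auto simp: chains_via_def)
      have c': "keys (restrict_keys (\<lambda>xs. \<not> ?inA xs) c) \<subseteq>
          {xs \<in> chains_via r x y {w. (a, w) \<in> r} n. \<not> ?inA xs}"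
        by (rule keys_restrict_keys_subset[OF insert.prems(2)]) (auto simp: chains_via_def)
      have c3: "keys c3 \<subseteq> {xs \<in> chains_between r x y n. \<exists>ws. xs = x # a # ws}"
        unfolding c3_def by (rule keys_restrict_keys_subset[OF c']) (auto simp: chains_via_def)
      have c2: "keys c2 \<subseteq> chains_via r x y {w. poset_less r a w} n"
        unfolding c2_def
        by (rule keys_restrict_keys_subset[OF c']) (auto simp: chains_via_def poset_less_def)

      define e0 where "e0 = pushforward tl c3"
      have e0: "keys e0 \<subseteq> chains_between r a y n'"
        unfolding e0_def by (rule keys_pushforward_subset[OF c3]) (auto simp: Suc chains_between_Suc)
      have c3_eq: "c3 = cone x e0"
        unfolding e0_def pushforward_pushforward
        by (rule pushforward_ident[symmetric]) (use c3 in auto)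

      have upa: "r `` {w. poset_less r a w} \<subseteq> {w. poset_less r a w}"
        using poset_less_le_trans[OF po] by blast
      have rehead_a: "keys (rehead a b) \<subseteq> chains_between r a y k"
        if "keys b \<subseteq> chains_via r x y {w. poset_less r a w} k" for b :: "'p list \<Rightarrow>\<^sub>0 'k" and k
        by (rule keys_pushforward_subset[OF that], cases k)
          (auto simp: chains_between_Suc chains_via_Suc)
      have bc2: "keys (boundary c2) \<subseteq> chains_via r x y {w. poset_less r a w} n'"
        by (rule keys_boundary_chains_via[OF po upa]) (use c2 Suc in auto)
      \<comment> \<open>The correction is what remains of \<open>c2\<close> after a has been
        inserted into its chains: \<open>boundary d1\<close> cancels \<open>c2\<close> and leaves
        the cone over the reheaded boundary of \<open>c2\<close>.\<close>
      define e where "e = e0 - rehead a (boundary c2)"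
      have e: "keys e \<subseteq> chains_between r a y n'"
        unfolding e_def by (rule keys_minus_subset[OF e0 rehead_a[OF bc2]])
      define d1 where "d1 = cone x (rehead a c2)"
      have d1: "keys d1 \<subseteq> chains_via r x y (r `` insert a A) (Suc n)"
        unfolding d1_def
      proof (rule keys_pushforward_subset[OF rehead_a[OF c2]])
        fix zs assume zs: "zs \<in> chains_between r a y n"
        then obtain ws where "zs = a # ws" using chains_between_ConsD by fast
        with zs xa refl[OF aF] show "x # zs \<in> chains_via r x y (r `` insert a A) (Suc n)"
          by (auto simp: chains_via_Suc)
      qed
      have "boundary d1 = - rehead x (rehead a c2) - cone x (boundary (rehead a c2))"
        unfolding d1_def
        by (rule boundary_cone) (use rehead_a[OF c2] Suc in \<open>auto simp: chains_between_def\<close>)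
      also have "rehead x (rehead a c2) = c2"
        unfolding pushforward_pushforward
        by (rule pushforward_ident) (use c2 in \<open>auto simp: chains_via_def\<close>)
      finally have bd1: "boundary d1 = - c2 - cone x (rehead a (boundary c2))"
        by (simp add: boundary_rehead)
      have c_d1: "c + boundary d1 = c1 + cone x e"
        unfolding bd1 c_split c3_eq e_def by (simp add: pushforward_diff)

      \<comment> \<open>The atoms of [a, y] along which the cone is glued. The next two facts
        identify the elements above \<open>A'\<close> and below y as those strictly above a that
        also lie above an element of A; only the second uses semimodularity.\<close>
      define A' where "A' = {z. covered_by r a z \<and> (z, y) \<in> r \<and> (\<exists>b\<in>A. covered_by r b z)}"
      have A'A: "r `` A' \<subseteq> r `` A"
      proof
        fix w assume "w \<in> r `` A'"
        then obtain z b where "(z, w) \<in> r" "b \<in> A" "covered_by r b z" by (auto simp: A'_def)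
        then show "w \<in> r `` A"
          using trans[of b z w] by (auto simp: covered_by_def poset_less_def)
      qed
      have AA': "w \<in> r `` A'" if w: "w \<in> r `` A" "poset_less r a w" "(w, y) \<in> r" for w
      proof -
        obtain b where b: "b \<in> A" "(b, w) \<in> r" using w(1) by blast
        then have "b \<noteq> a" using insert.hyps(2) by blast
        moreover have "(a, w) \<in> r" using w(2) by (simp add: poset_less_def)
        ultimately obtain z where z: "covered_by r a z" "covered_by r b z" "(z, w) \<in> r"
          using totally_semimodularD(3)[OF tsm a(1), of b w] A[OF b(1)] b(2) by blast
        then have "z \<in> A'" using b(1) trans[OF z(3) w(3)] by (auto simp: A'_def)
        with z(3) show ?thesis by blast
      qed

      have "\<exists>f. keys f \<subseteq> chains_via r a y (r `` A') n \<and> boundary f = e"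
      proof (cases n')
        case 0
        with e \<open>a \<noteq> y\<close> have "e = 0" by (simp add: chains_between_0)
        then show ?thesis by (intro exI[of _ 0]) (simp add: boundary_0)
      next
        case (Suc k)
        have cyc: "boundary (c1 + cone x e) = 0"
          unfolding c_d1[symmetric] by (simp add: boundary_add boundary_boundary insert.prems(3))
        have "keys c1 \<subseteq> chains_via r x y (r `` A) (Suc (Suc k))"
          and "keys e \<subseteq> chains_between r a y (Suc k)"
          using c1 e \<open>n = Suc n'\<close> Suc by auto
        note be = cone_rehead_cycle(1)[OF po up aA xa this cyc]
          and re = cone_rehead_cycle(2)[OF po up aA xa this cyc]
        have "keys (boundary c1) \<subseteq> chains_via r x y (r `` A) n'"
          by (rule keys_boundary_chains_via[OF po up]) (use c1 \<open>n = Suc n'\<close> in auto)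
        then have kre: "keys (rehead x e) \<subseteq> chains_via r x y (r `` A) n'"
          unfolding re .
        \<comment> \<open>Replacing the first element is injective on chains that start at a, so no
          coefficient of \<open>e\<close> cancels in \<open>rehead x e\<close>. As this equals
          \<open>boundary c1\<close>, the second elements of the chains of \<open>e\<close> lie
          above A.\<close>
        have "keys e \<subseteq> chains_via r a y (r `` A') n'"
        proof
          fix xs assume xs: "xs \<in> keys e"
          obtain w ws where w: "xs = a # w # ws" "poset_less r a w"
            "w # ws \<in> chains_between r w y k"
            using subsetD[OF e xs] unfolding Suc chains_between_Suc by blast
          have "inj_on (\<lambda>xs. x # tl xs) (keys e)"
            by (rule inj_on_subset[OF _ e]) (auto simp: inj_on_def Suc chains_between_Suc)
          from keys_pushforward_inj[OF this xs] kre w(1) have "w \<in> r `` A"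
            by (auto simp: chains_via_def)
          with AA' w(2) chains_between_le[OF po y w(3)] have "w \<in> r `` A'" by simp
          with w show "xs \<in> chains_via r a y (r `` A') n'"
            unfolding Suc chains_via_Suc by simp
        qed
        moreover have "n' < m" using Suc.prems(2) \<open>n = Suc n'\<close> by simp
        moreover have "A' \<subseteq> {z. covered_by r a z \<and> (z, y) \<in> r}" by (auto simp: A'_def)
        ultimately show ?thesis
          using Suc.IH[OF max_a _ _ _ be] \<open>n = Suc n'\<close> by simp
      qed
      then obtain f where f: "keys f \<subseteq> chains_via r a y (r `` A') n" "boundary f = e" by blast

      have bcf: "boundary (cone x f) = - rehead x f - cone x e"
        unfolding f(2)[symmetric] by (rule boundary_cone) (use f(1) in \<open>auto simp: chains_via_def\<close>)
      have kcf: "keys (cone x f) \<subseteq> chains_via r x y (r `` insert a A) (Suc n)"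
        by (rule keys_pushforward_subset[OF f(1)])
          (use xa refl[OF aF] in \<open>auto simp: chains_via_def chains_between_Suc\<close>)
      have krf: "keys (rehead x f) \<subseteq> chains_via r x y (r `` A) n"
      proof (rule keys_pushforward_subset[OF f(1)])
        fix xs assume "xs \<in> chains_via r a y (r `` A') n"
        then obtain w ws where w: "xs = a # w # ws" "poset_less r a w" "w \<in> r `` A'"
          "w # ws \<in> chains_between r w y n'"
          unfolding Suc chains_via_Suc by blast
        moreover have "poset_less r x w" using poset_less_trans[OF po xa w(2)] .
        moreover have "w \<in> r `` A" using A'A w(3) by (rule subsetD)
        ultimately show "x # tl xs \<in> chains_via r x y (r `` A) n"
          unfolding Suc chains_via_Suc by simp
      qed
      \<comment> \<open>The two cones over \<open>e\<close> cancel, which leaves a cycle in the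
        complex of A that is homologous to \<open>c\<close>.\<close>
      have c_eq: "c1 - rehead x f = c + boundary (d1 + cone x f)"
      proof -
        have "c + boundary (d1 + cone x f) = (c + boundary d1) + boundary (cone x f)"
          by (simp add: boundary_add add.assoc)
        also have "\<dots> = c1 - rehead x f" unfolding c_d1 bcf by simp
        finally show ?thesis ..
      qed
      have "keys (c1 - rehead x f) \<subseteq> chains_via r x y (r `` A) n"
        by (rule keys_minus_subset[OF c1 krf])
      moreover have "boundary (c1 - rehead x f) = 0"
        unfolding c_eq boundary_add[of c] by (simp add: boundary_boundary insert.prems(3))
      moreover have "A \<subseteq> {a. covered_by r x a \<and> (a, y) \<in> r}" using insert.prems(1) by simp
      ultimately obtain g where g: "keys g \<subseteq> chains_via r x y (r `` A) (Suc n)"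
        "boundary g = c1 - rehead x f"
        using insert.IH by meson
      have "boundary (g - (d1 + cone x f)) = c"
        using g(2) c_eq by (simp add: boundary_diff)
      moreover have "keys g \<subseteq> chains_via r x y (r `` insert a A) (Suc n)"
        by (rule order.trans[OF g(1) chains_via_mono]) blast
      then have "keys (g - (d1 + cone x f)) \<subseteq> chains_via r x y (r `` insert a A) (Suc n)"
        by (rule keys_minus_subset[OF _ keys_add_subset[OF d1 kcf]])
      ultimately show ?thesis by blast
    qed
  qed
qed simp

section \<open>From sets of atoms to the homology of whole intervals\<close>

lemma maximal_chains_concat:
  assumes "maximal_chains r x w k \<noteq> {}" "maximal_chains r w y l \<noteq> {}"
  shows "maximal_chains r x y (k + l) \<noteq> {}"
  using assms(1)
proof (induction k arbitrary: x)
  case 0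
  with assms(2) show ?case by (simp add: maximal_chains_0 split: if_splits)
next
  case (Suc k)
  then show ?case unfolding add_Suc maximal_chains_Suc_nonempty by blast
qed

text \<open>Every strict step is filled by a maximal chain of positive length. Hence there are no
  chains in degrees above the rank.\<close>

lemma chain_refines_to_maximal_chain:
  assumes fin: "finite (Field r)" and po: "Partial_order r"
    and "xs \<in> chains_between r x y n"
  shows "\<exists>m\<ge>n. maximal_chains r x y m \<noteq> {}"
  using assms(3)
proof (induction n arbitrary: x xs)
  case 0
  then show ?case
    by (intro exI[of _ 0]) (auto simp: chains_between_0 maximal_chains_0 split: if_splits)
next
  case (Suc n)
  then obtain w ws where w: "poset_less r x w" "w # ws \<in> chains_between r w y n"
    unfolding chains_between_Suc by blast
  then obtain m where m: "n \<le> m" "maximal_chains r w y m \<noteq> {}"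
    using Suc.IH by blast
  obtain k where k: "maximal_chains r x w k \<noteq> {}"
    using maximal_chain_exists[OF fin po, of x w] w(1) by (auto simp: poset_less_def)
  have "k \<noteq> 0"
    using k w(1) by (auto simp: maximal_chains_0 poset_less_def split: if_splits)
  with m(1) maximal_chains_concat[OF k m(2)] show ?case
    by (intro exI[of _ "k + m"]) simp
qed

lemma acyclic_chains_between:
  fixes c :: "'p list \<Rightarrow>\<^sub>0 'k::comm_ring_1"
  assumes tsm: "totally_semimodular r" and xy: "(x, y) \<in> r"
    and n: "n \<noteq> interval_rank r x y"
    and c: "keys c \<subseteq> chains_between r x y n" "boundary c = 0"
  shows "\<exists>d. keys d \<subseteq> chains_between r x y (Suc n) \<and> boundary d = c"
proof (cases "chains_between r x y n = {}")
  case True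
  with c(1) have "c = 0" by simp
  then show ?thesis by (intro exI[of _ 0]) (simp add: boundary_0)
next
  case False
  note fin = totally_semimodularD(1)[OF tsm] and po = totally_semimodularD(2)[OF tsm]
  have y: "y \<in> Field r" using xy by (auto simp: Field_def)
  obtain m where m: "n \<le> m" "maximal_chains r x y m \<noteq> {}"
    using chain_refines_to_maximal_chain[OF fin po] False by blast
  have "interval_rank r x y = m"
    unfolding interval_rank_def
    using m(2) maximal_chain_lengths_eq[OF tsm y] by (intro the_equality) blast+
  with n m(1) have "n < m" by simp
  let ?A = "{a. covered_by r x a \<and> (a, y) \<in> r}"
  \<comment> \<open>With all atoms allowed the condition is void, except in degree 0, where the only
    possible chain \<open>[x]\<close> has no second element. That degree is treated apart below: a
    chain there means x = y, so the rank is 0 as well.\<close>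
  have via: "chains_via r x y (r `` ?A) k = chains_between r x y k" if "0 < k" for k
  proof
    show "chains_between r x y k \<subseteq> chains_via r x y (r `` ?A) k"
    proof
      fix xs assume xs: "xs \<in> chains_between r x y k"
      with \<open>0 < k\<close> obtain w ws where w: "xs = x # w # ws" "poset_less r x w"
        "w # ws \<in> chains_between r w y (k - 1)"
        by (cases k) (auto simp: chains_between_Suc)
      obtain a where a: "covered_by r x a" "(a, w) \<in> r"
        using obtain_cover[OF fin po w(2)] .
      have "(w, y) \<in> r" using chains_between_le[OF po y w(3)] .
      with a(2) have "(a, y) \<in> r" by (rule poset_trans[OF po])
      with a xs w(1) show "xs \<in> chains_via r x y (r `` ?A) k"
        by (auto simp: chains_via_def)
    qed
  qed (auto simp: chains_via_def)
  show ?thesis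
  proof (cases n)
    case 0
    with False have "x = y" by (simp add: chains_between_0 split: if_splits)
    then have "maximal_chains r x y 0 \<noteq> {}" by (simp add: maximal_chains_0)
    with m(2) \<open>n < m\<close> 0 show ?thesis using maximal_chain_lengths_eq[OF tsm y] by blast
  next
    case (Suc n')
    then show ?thesis
      using acyclic_chains_via[OF tsm y m(2) \<open>n < m\<close> order_refl, of c] c via[of n] via[of "Suc n"]
      by simp
  qed
qed

text \<open>Boundaries and cycles are the same set, so the homology is a group modulo
  itself.\<close>

lemma trivial_interval_homology:
  fixes r :: "'p rel" and x y n
  defines "H \<equiv> interval_homology r x y n :: ('p list \<Rightarrow>\<^sub>0 'k::comm_ring_1) set monoid"
  assumes po: "Partial_order r"
    and acyclic: "\<And>c :: 'p list \<Rightarrow>\<^sub>0 'k. \<lbrakk>keys c \<subseteq> chains_between r x y n; boundary c = 0\<rbrakk> \<Longrightarrow>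
      \<exists>d. keys d \<subseteq> chains_between r x y (Suc n) \<and> boundary d = c"
  shows "trivial_group H"
proof -
  define Z :: "('p list \<Rightarrow>\<^sub>0 'k) set" where "Z = carrier (cycle_group r x y n)"
  have Z: "Z = {c. keys c \<subseteq> chains_between r x y n \<and> boundary c = 0}"
    by (simp add: Z_def cycle_group_def chain_module_def)
  have bZ: "boundary_set r x y n = Z"
  proof
    show "boundary_set r x y n \<subseteq> Z"
      unfolding boundary_set_def chain_module_def
    proof (rule image_subsetI)
      fix d :: "'p list \<Rightarrow>\<^sub>0 'k"
      assume "d \<in> {c. keys c \<subseteq> chains_between r x y (Suc n)}"
      then show "boundary d \<in> Z"
        using keys_boundary_chains_between[OF po] by (simp add: Z boundary_boundary)
    qed
    show "Z \<subseteq> boundary_set r x y n"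
      using acyclic unfolding Z boundary_set_def chain_module_def by blast
  qed
  have grp: "group (cycle_group r x y n :: ('p list \<Rightarrow>\<^sub>0 'k) monoid)"
  proof (rule groupI)
    fix c :: "'p list \<Rightarrow>\<^sub>0 'k" assume "c \<in> carrier (cycle_group r x y n)"
    then show "\<exists>d\<in>carrier (cycle_group r x y n).
        d \<otimes>\<^bsub>cycle_group r x y n\<^esub> c = \<one>\<^bsub>cycle_group r x y n\<^esub>"
      by (intro bexI[of _ "- c"]) (auto simp: cycle_group_def chain_module_def boundary_minus)
  qed (auto simp: cycle_group_def chain_module_def boundary_0 boundary_add add.assoc
      dest: subsetD[OF keys_add])
  have cgrp: "comm_group (cycle_group r x y n :: ('p list \<Rightarrow>\<^sub>0 'k) monoid)"
    using grp by (rule group.group_comm_groupI) (simp add: cycle_group_def add.commute)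
  have H: "H = cycle_group r x y n Mod carrier (cycle_group r x y n)"
    unfolding H_def interval_homology_def bZ Z_def ..
  have sub: "subgroup (carrier (cycle_group r x y n)) (cycle_group r x y n :: ('p list \<Rightarrow>\<^sub>0 'k) monoid)"
    using grp by (rule group.subgroup_self)
  have "carrier H \<subseteq> {\<one>\<^bsub>H\<^esub>}"
    unfolding H carrier_FactGroup one_FactGroup
    using group.coset_join2[OF grp _ sub] by blast
  moreover have "group H"
    unfolding H using comm_group.abelian_FactGroup[OF cgrp sub] comm_group.axioms(2) by blast
  ultimately show ?thesis
    using group.trivial_group_subset by blast
qed

section \<open>Opposite posets\<close>

lemma poset_less_converse [simp]: "poset_less (r\<inverse>) x y \<longleftrightarrow> poset_less r y x"
  by (auto simp: poset_less_def)

lemma covered_by_converse [simp]: "covered_by (r\<inverse>) x y \<longleftrightarrow> covered_by r y x"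
  by (auto simp: covered_by_def)

lemma rev_in_chains_between_converse:
  "rev xs \<in> chains_between (r\<inverse>) y x n \<longleftrightarrow> xs \<in> chains_between r x y n"
  by (cases "xs = []") (auto simp: chains_between_def hd_rev last_rev)

lemma rev_in_maximal_chains_converse:
  "rev xs \<in> maximal_chains (r\<inverse>) y x n \<longleftrightarrow> xs \<in> maximal_chains r x y n"
  by (cases "xs = []") (auto simp: maximal_chains_def hd_rev last_rev)

lemma maximal_chains_converse_nonempty:
  "maximal_chains (r\<inverse>) y x n \<noteq> {} \<longleftrightarrow> maximal_chains r x y n \<noteq> {}"
  using rev_in_maximal_chains_converse[of _ r y x n] by (metis ex_in_conv rev_rev_ident)

lemma interval_rank_converse: "interval_rank (r\<inverse>) y x = interval_rank r x y"
  by (simp only: interval_rank_def maximal_chains_converse_nonempty)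

lemma graded_poset_converse: "graded_poset (r\<inverse>) \<longleftrightarrow> graded_poset r"
  unfolding graded_poset_def maximal_chains_converse_nonempty by (simp, blast)

theorem cohen_macaulay_totally_semimodular_converse:
  fixes r :: "'p rel"
  assumes tsm: "totally_semimodular (r\<inverse>)"
  shows "cohen_macaulay TYPE('k::comm_ring_1) r"
  unfolding cohen_macaulay_def
proof (intro conjI allI impI)
  show "graded_poset r"
    using graded_poset_totally_semimodular[OF tsm] by (simp add: graded_poset_converse)
  then have po: "Partial_order r" by (simp add: graded_poset_def)
  fix x y n
  assume "(x, y) \<in> r \<and> n \<noteq> interval_rank r x y"
  then have xy: "(y, x) \<in> r\<inverse>" and n: "n \<noteq> interval_rank (r\<inverse>) y x"
    by (auto simp: interval_rank_converse)
  show "trivial_group (interval_homology r x y n :: ('p list \<Rightarrow>\<^sub>0 'k) set monoid)"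
  proof (rule trivial_interval_homology[OF po])
    fix c :: "'p list \<Rightarrow>\<^sub>0 'k"
    assume c: "keys c \<subseteq> chains_between r x y n" "boundary c = 0"
    define R where "R = (pushforward rev :: ('p list \<Rightarrow>\<^sub>0 'k) \<Rightarrow> _)"
    \<comment> \<open>Multiplication by \<open>(-1) ^ k\<close>. Reversing a filling of the reversed
      cycle fills the original one up to this sign for degree \<open>Suc n\<close>.\<close>
    define s where "s k = (if even k then id else uminus :: ('p list \<Rightarrow>\<^sub>0 'k) \<Rightarrow> _)" for k :: nat
    have "keys (R c) \<subseteq> chains_between (r\<inverse>) y x n"
      unfolding R_def
      by (rule keys_pushforward_subset[OF c(1)]) (simp add: rev_in_chains_between_converse)
    moreover have "boundary (R c) = s n (R (boundary c))"
      unfolding R_def s_def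
      by (rule boundary_rev) (use c(1) in \<open>auto simp: chains_between_def\<close>)
    then have "boundary (R c) = 0"
      by (simp add: c(2) R_def s_def pushforward_0)
    ultimately obtain g where g: "keys g \<subseteq> chains_between (r\<inverse>) y x (Suc n)" "boundary g = R c"
      using acyclic_chains_between[OF tsm xy n] by blast
    have "boundary (R g) = s (Suc n) (R (boundary g))"
      unfolding R_def s_def
      by (rule boundary_rev) (use g(1) in \<open>auto simp: chains_between_def\<close>)
    also have "R (boundary g) = c"
      unfolding g(2) R_def pushforward_pushforward by (rule pushforward_ident) simp
    finally have "boundary (s (Suc n) (R g)) = c"
      by (simp add: s_def boundary_minus)
    moreover have "keys (R g) \<subseteq> chains_between r x y (Suc n)"
      unfolding R_def
      by (rule keys_pushforward_subset[OF g(1)])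
        (metis rev_in_chains_between_converse rev_rev_ident)
    then have "keys (s (Suc n) (R g)) \<subseteq> chains_between r x y (Suc n)"
      by (simp add: s_def)
    ultimately show "\<exists>d. keys d \<subseteq> chains_between r x y (Suc n) \<and> boundary d = c" by blast
  qed
qed

section \<open>Pointed partitions as idempotent maps\<close>

text \<open>Values outside S are unconstrained, so a pointed partition determines f only on S;
  equality is therefore always expressed through \<open>fibres\<close>.\<close>

definition idem :: "'a set \<Rightarrow> ('a \<Rightarrow> 'a) \<Rightarrow> bool" where
  "idem S f \<longleftrightarrow> (\<forall>s\<in>S. f s \<in> S \<and> f (f s) = f s)"

definition idem_le :: "'a set \<Rightarrow> ('a \<Rightarrow> 'a) \<Rightarrow> ('a \<Rightarrow> 'a) \<Rightarrow> bool" where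
  "idem_le S f g \<longleftrightarrow> (\<forall>s\<in>S. f (g s) = f s \<and> g (f s) = f s)"

definition fibres :: "'a set \<Rightarrow> ('a \<Rightarrow> 'a) \<Rightarrow> ('a set \<times> 'a) set" where
  "fibres S f = (\<lambda>p. ({s \<in> S. f s = p}, p)) ` f ` S"

lemma snd_fibres [simp]: "snd ` fibres S f = f ` S"
  by (auto simp: fibres_def image_image)

lemma fibres_cong: "(\<And>s. s \<in> S \<Longrightarrow> f s = g s) \<Longrightarrow> fibres S f = fibres S g"
  by (auto simp: fibres_def image_def)

lemma idem_in_image: "idem S f \<Longrightarrow> p \<in> f ` S \<Longrightarrow> p \<in> S \<and> f p = p"
  by (auto simp: idem_def)

lemma fibres_in_pointed_partitions:
  assumes "idem S f"
  shows "fibres S f \<in> pointed_partitions S"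
proof -
  have "partition_on S (fst ` fibres S f)"
  proof (rule partition_onI)
    show "\<Union> (fst ` fibres S f) = S" by (auto simp: fibres_def)
    show "{} \<notin> fst ` fibres S f" by (auto simp: fibres_def)
    show "disjnt p q" if "p \<in> fst ` fibres S f" "q \<in> fst ` fibres S f" "p \<noteq> q" for p q
      using that by (auto simp: fibres_def disjnt_def)
  qed
  moreover have "inj_on fst (fibres S f)" by (auto simp: fibres_def inj_on_def)
  moreover have "\<forall>(B, b)\<in>fibres S f. b \<in> B" using assms by (auto simp: fibres_def idem_def)
  ultimately show ?thesis by (simp add: pointed_partitions_def)
qed

lemma pointed_partition_eq_fibres:
  assumes X: "X \<in> pointed_partitions S"
  obtains f where "idem S f" "X = fibres S f"
proof -
  have part: "partition_on S (fst ` X)" and inj: "inj_on fst X"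
    and pt: "\<And>B b. (B, b) \<in> X \<Longrightarrow> b \<in> B"
    using X by (auto simp: pointed_partitions_def)
  have sub: "B \<subseteq> S" if "(B, b) \<in> X" for B b
    using partition_onD1[OF part] that by force
  have same: "B = C \<and> b = c" if "(B, b) \<in> X" "(C, c) \<in> X" "s \<in> B" "s \<in> C" for B C b c s
  proof -
    have "B \<in> fst ` X" "C \<in> fst ` X" using that by force+
    then have "B = C" using partition_onD2[OF part] that(3,4) by (auto simp: disjoint_def)
    then show ?thesis using inj_onD[OF inj, of "(B, b)" "(C, c)"] that(1,2) by simp
  qed
  define f where "f s = (THE b. \<exists>B. (B, b) \<in> X \<and> s \<in> B)" for s
  have f: "f s = b" if "(B, b) \<in> X" "s \<in> B" for B b s
    unfolding f_def using that same by (intro the_equality) blast+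
  have ex: "\<exists>B. (B, f s) \<in> X \<and> s \<in> B" if "s \<in> S" for s
  proof -
    obtain B b where "(B, b) \<in> X" "s \<in> B" using partition_onD1[OF part] \<open>s \<in> S\<close> by auto
    with f show ?thesis by metis
  qed
  have "idem S f"
    unfolding idem_def
  proof
    fix s assume "s \<in> S"
    then obtain B where "(B, f s) \<in> X" using ex by blast
    then show "f s \<in> S \<and> f (f s) = f s" using pt sub f by blast
  qed
  moreover have fib: "{s \<in> S. f s = b} = B" if "(B, b) \<in> X" for B b
  proof
    show "B \<subseteq> {s \<in> S. f s = b}" using f[OF that] sub[OF that] by blast
    show "{s \<in> S. f s = b} \<subseteq> B"
    proof
      fix s assume s: "s \<in> {s \<in> S. f s = b}"
      then obtain C where C: "(C, b) \<in> X" "s \<in> C" using ex[of s] by auto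
      with same[OF that C(1) pt[OF that] pt[OF C(1)]] show "s \<in> B" by simp
    qed
  qed
  have "X = fibres S f"
  proof
    show "X \<subseteq> fibres S f"
    proof (rule subrelI)
      fix B b assume B: "(B, b) \<in> X"
      have "b \<in> S" "f b = b" using f[OF B pt[OF B]] pt[OF B] sub[OF B] by auto
      then have "b \<in> f ` S" by (metis imageI)
      then show "(B, b) \<in> fibres S f" using fib[OF B] by (auto simp: fibres_def)
    qed
    show "fibres S f \<subseteq> X"
    proof
      fix Y assume "Y \<in> fibres S f"
      then obtain s where "s \<in> S" "Y = ({t \<in> S. f t = f s}, f s)" by (auto simp: fibres_def)
      moreover from this(1) obtain B where "(B, f s) \<in> X" using ex by blast
      ultimately show "Y \<in> X" using fib[of B "f s"] by simp
    qed
  qed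
  ultimately show ?thesis using that by blast
qed

text \<open>The equation \<open>f (g s) = f s\<close> says that blocks of g lie inside blocks of f,
  and \<open>g (f s) = f s\<close> that points of f are points of g. Together they place the block
  of g pointed at \<open>f s\<close> inside the block of f with that point.\<close>

lemma fibres_le_iff:
  assumes f: "idem S f" and g: "idem S g"
  shows "(fibres S f, fibres S g) \<in> perm_poset S \<longleftrightarrow> idem_le S f g"
proof
  assume le: "(fibres S f, fibres S g) \<in> perm_poset S"
  show "idem_le S f g"
    unfolding idem_le_def
  proof (intro ballI conjI)
    fix s assume s: "s \<in> S"
    have "{t \<in> S. g t = g s} \<in> fst ` fibres S g" using s by (force simp: fibres_def)
    then obtain q where "{t \<in> S. g t = g s} \<subseteq> {t \<in> S. f t = q}"
      using le by (fastforce simp: perm_poset_def refines_def fibres_def)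
    then show "f (g s) = f s" using s g by (auto simp: idem_def)
    have "({t \<in> S. f t = f s}, f s) \<in> fibres S f" using s by (auto simp: fibres_def)
    moreover have "\<forall>(B, b)\<in>fibres S f. \<exists>(C, c)\<in>fibres S g. C \<subseteq> B \<and> b = c"
      using le by (simp add: perm_poset_def)
    ultimately obtain C where "(C, f s) \<in> fibres S g" by fast
    then have "f s \<in> g ` S" by (auto simp: fibres_def)
    then show "g (f s) = f s" using idem_in_image[OF g] by blast
  qed
next
  assume le: "idem_le S f g"
  have pp: "fibres S f \<in> pointed_partitions S" "fibres S g \<in> pointed_partitions S"
    using fibres_in_pointed_partitions f g by auto
  have "\<exists>Y\<in>fst ` fibres S f. X \<subseteq> Y" if X: "X \<in> fst ` fibres S g" for X
  proof -
    obtain s where s: "s \<in> S" "X = {t \<in> S. g t = g s}" using X by (auto simp: fibres_def)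
    have "f t = f s" if "t \<in> S" "g t = g s" for t
    proof -
      have "f (g t) = f t" "f (g s) = f s" using le that(1) s(1) by (auto simp: idem_le_def)
      with that(2) show ?thesis by simp
    qed
    then have "X \<subseteq> {t \<in> S. f t = f s}" unfolding s(2) by blast
    moreover have "{t \<in> S. f t = f s} \<in> fst ` fibres S f" using s(1) by (force simp: fibres_def)
    ultimately show ?thesis by blast
  qed
  then have "refines S (fst ` fibres S g) (fst ` fibres S f)"
    using pp by (auto simp: refines_def pointed_partitions_def)
  moreover have "\<exists>(C, c)\<in>fibres S g. C \<subseteq> B \<and> b = c" if "(B, b) \<in> fibres S f" for B b
  proof -
    obtain s where s: "s \<in> S" "B = {t \<in> S. f t = f s}" "b = f s"
      using \<open>(B, b) \<in> fibres S f\<close> by (auto simp: fibres_def)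
    have fs: "f s \<in> S" "f (f s) = f s" "g (f s) = f s"
      using f le s(1) by (auto simp: idem_def idem_le_def)
    have "f t = f s" if "t \<in> S" "g t = f s" for t
    proof -
      have "f (g t) = f t" using le that(1) by (auto simp: idem_le_def)
      with that(2) fs(2) show ?thesis by simp
    qed
    then have "{t \<in> S. g t = f s} \<subseteq> B" unfolding s(2) by blast
    moreover have "({t \<in> S. g t = f s}, f s) \<in> fibres S g"
      unfolding fibres_def using imageI[OF fs(1), of g] fs(3) by simp
    ultimately show ?thesis using s(3) by blast
  qed
  ultimately show "(fibres S f, fibres S g) \<in> perm_poset S"
    using pp by (auto simp: perm_poset_def)
qed

section \<open>The natural order of idempotents and removal of points\<close>

lemma idem_le_refl: "idem S f \<Longrightarrow> idem_le S f f"
  by (simp add: idem_def idem_le_def)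

lemma idem_le_trans:
  assumes "idem S f" "idem S h" "idem_le S f g" "idem_le S g h"
  shows "idem_le S f h"
  unfolding idem_le_def
proof (intro ballI conjI)
  fix s assume s: "s \<in> S"
  have "f s \<in> S" "h s \<in> S" using assms(1,2) s by (auto simp: idem_def)
  note at = bspec[OF assms(3)[unfolded idem_le_def]] bspec[OF assms(4)[unfolded idem_le_def]]
  note * = at[OF s] at[OF \<open>f s \<in> S\<close>] at[OF \<open>h s \<in> S\<close>]
  show "f (h s) = f s" using * by metis
  show "h (f s) = f s" using * by metis
qed

lemma idem_le_image: "idem_le S f g \<Longrightarrow> idem S f \<Longrightarrow> f ` S \<subseteq> g ` S"
  by (force simp: idem_le_def idem_def)

text \<open>If no point is lost, f fixes \<open>g s\<close>, while \<open>f (g s) = f s\<close>. So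
  a strict descent loses a point, which makes the set of points behave like a rank.\<close>

lemma idem_le_eq:
  assumes "idem S f" "idem S g" "idem_le S f g" "g ` S \<subseteq> f ` S"
  shows "fibres S f = fibres S g"
proof (rule fibres_cong)
  fix s assume s: "s \<in> S"
  then have "f (g s) = g s" using assms(4) idem_in_image[OF assms(1), of "g s"] by blast
  with s assms(3) show "f s = g s" by (simp add: idem_le_def)
qed

text \<open>Redirecting a to \<alpha> and c to \<gamma> after e loses exactly these two points. The
  result stays above h because h does not distinguish a removed point from its target and has
  neither removed point in its image.\<close>

lemma idem_kill_two:
  assumes e: "idem S e" and h: "idem S h" and he: "idem_le S h e"
    and ac: "a \<in> e ` S" "c \<in> e ` S" "a \<noteq> c" "a \<notin> h ` S" "c \<notin> h ` S"
    and \<alpha>: "\<alpha> \<in> e ` S - {a, c}" "h \<alpha> = h a" and \<gamma>: "\<gamma> \<in> e ` S - {a, c}" "h \<gamma> = h c"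
  obtains k where "idem S k" "idem_le S k e" "idem_le S h k" "k ` S = e ` S - {a, c}"
    "k a = \<alpha>" "k c = \<gamma>" "\<And>p. p \<in> e ` S - {a, c} \<Longrightarrow> k p = p"
proof
  let ?k = "\<lambda>s. if e s = a then \<alpha> else if e s = c then \<gamma> else e s"
  note fix_e = idem_in_image[OF e]
  have ker: "?k s \<in> e ` S - {a, c}" if "s \<in> S" for s using \<alpha>(1) \<gamma>(1) that by auto
  show fix_k: "?k p = p" if "p \<in> e ` S - {a, c}" for p using that fix_e[of p] by auto
  show "?k a = \<alpha>" "?k c = \<gamma>" using ac fix_e[OF ac(1)] fix_e[OF ac(2)] by auto
  show "idem S ?k" unfolding idem_def
  proof (intro ballI conjI)
    fix s assume s: "s \<in> S"
    have "?k s \<in> e ` S" using ker[OF s] by (rule DiffD1)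
    then show "?k s \<in> S" using fix_e by fast
    show "?k (?k s) = ?k s" by (rule fix_k[OF ker[OF s]])
  qed
  show "?k ` S = e ` S - {a, c}"
  proof
    show "?k ` S \<subseteq> e ` S - {a, c}" by (rule image_subsetI) (rule ker)
    show "e ` S - {a, c} \<subseteq> ?k ` S"
    proof
      fix p assume p: "p \<in> e ` S - {a, c}"
      then have "p \<in> S" using fix_e by fast
      then show "p \<in> ?k ` S" using fix_k[OF p] by (intro image_eqI[of _ _ p]) simp_all
    qed
  qed
  show "idem_le S ?k e" unfolding idem_le_def
  proof (intro ballI conjI)
    fix s assume s: "s \<in> S"
    then show "?k (e s) = ?k s" using e by (simp add: idem_def)
    have "?k s \<in> e ` S" using ker[OF s] by (rule DiffD1)
    then show "e (?k s) = ?k s" using fix_e by fast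
  qed
  show "idem_le S h ?k" unfolding idem_le_def
  proof (intro ballI conjI)
    fix s assume s: "s \<in> S"
    have "h (e s) = h s" "e (h s) = h s" using he s by (auto simp: idem_le_def)
    moreover have "h s \<noteq> a" "h s \<noteq> c" using ac(4,5) imageI[OF s, of h] by auto
    ultimately show "h (?k s) = h s" "?k (h s) = h s" using \<alpha>(2) \<gamma>(2) by auto
  qed
qed

text \<open>Such an f is e followed by moving the single point a to \<open>f a\<close>; all other
  points of e are fixed. So k has to be compared with f only at a.\<close>

lemma idem_le_cover:
  assumes e: "idem S e" and f: "idem S f" and k: "idem S k"
    and fe: "idem_le S f e" and ke: "idem_le S k e"
    and im: "f ` S = e ` S - {a}" "a \<notin> k ` S" and a: "k (f a) = k a"
  shows "idem_le S k f"
  unfolding idem_le_def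
proof (intro ballI conjI)
  fix s assume s: "s \<in> S"
  have fs: "f s = f (e s)" and ks: "k s = k (e s)" using fe ke s by (auto simp: idem_le_def)
  show "k (f s) = k s"
  proof (cases "e s = a")
    case False
    with s im(1) have "e s \<in> f ` S" by blast
    then have "f (e s) = e s" using idem_in_image[OF f] by blast
    with fs ks show ?thesis by simp
  qed (use fs ks a in simp)
  have "k s \<in> e ` S" using idem_le_image[OF ke k] s by blast
  with im s have "k s \<in> f ` S" by blast
  then show "f (k s) = k s" using idem_in_image[OF f] by blast
qed

lemma idem_semimodular:
  assumes e: "idem S e" and f: "idem S f" and g: "idem S g" and h: "idem S h"
    and fe: "idem_le S f e" and ge: "idem_le S g e" and hf: "idem_le S h f" and hg: "idem_le S h g"
    and a: "a \<in> e ` S" "f ` S = e ` S - {a}" and c: "c \<in> e ` S" "g ` S = e ` S - {c}"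
    and neq: "fibres S f \<noteq> fibres S g"
  obtains k p q where "idem S k" "idem_le S k f" "idem_le S k g" "idem_le S h k"
    "p \<in> f ` S" "k ` S = f ` S - {p}" "q \<in> g ` S" "k ` S = g ` S - {q}"
proof -
  note result = that
  have he: "idem_le S h e" using idem_le_trans[OF h e hf fe] .
  have aS: "a \<in> S" and cS: "c \<in> S" 
    using idem_in_image[OF e a(1)] idem_in_image[OF e c(1)] by simp_all
  have fa: "f a \<in> e ` S" "f a \<noteq> a" "h (f a) = h a"
    using imageI[OF aS, of f] a(2) hf aS by (auto simp: idem_le_def)
  have gc: "g c \<in> e ` S" "g c \<noteq> c" "h (g c) = h c"
    using imageI[OF cS, of g] c(2) hg cS by (auto simp: idem_le_def)
  have hS: "h ` S \<subseteq> e ` S - {a, c}"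
    using idem_le_image[OF hf h] idem_le_image[OF hg h] unfolding a(2) c(2) by auto
  then have ah: "a \<notin> h ` S" and ch: "c \<notin> h ` S" by auto
  show ?thesis
  proof (cases "a = c")
    case False
    \<comment> \<open>For k below f, a must go to \<open>f a\<close> if that survives, and to the
      same target as c if \<open>f a = c\<close>; likewise for g. If both images are removed points,
      h has the same value at a and c, and this value survives because it lies in the image of
      h.\<close>
    obtain \<alpha> \<gamma> where \<alpha>: "\<alpha> \<in> e ` S - {a, c}" "h \<alpha> = h a" and \<gamma>: "\<gamma> \<in> e ` S - {a, c}" "h \<gamma> = h c"
      and f_a: "if f a = c then \<alpha> = \<gamma> else \<alpha> = f a" and g_c: "if g c = a then \<alpha> = \<gamma> else \<gamma> = g c"
    proof (cases "f a = c")
      case fac: True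
      show ?thesis
      proof (cases "g c = a")
        case True
        have "h a \<in> e ` S - {a, c}" using hS aS by blast
        moreover have "h (h a) = h a" using h aS by (simp add: idem_def)
        ultimately
        show ?thesis using that[of "h a" "h a"] fac fa(3) True by simp
      next
        case False
        then show ?thesis using that[of "g c" "g c"] fac fa(3) gc by simp
      qed
    next
      case fac: False
      show ?thesis
      proof (cases "g c = a")
        case True
        then show ?thesis using that[of "f a" "f a"] fac fa gc(3) by simp
      next
        case False
        then show ?thesis using that[of "f a" "g c"] fac fa gc by simp
      qed
    qed
    obtain k where k: "idem S k" "idem_le S k e" "idem_le S h k" "k ` S = e ` S - {a, c}"
      "k a = \<alpha>" "k c = \<gamma>" "\<And>p. p \<in> e ` S - {a, c} \<Longrightarrow> k p = p"
      using idem_kill_two[OF e h he a(1) c(1) False ah ch \<alpha> \<gamma>] by metis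
    have "k (f a) = k a" using f_a k(5,6) k(7)[of "f a"] fa by (auto split: if_splits)
    then have kf: "idem_le S k f"
      using idem_le_cover[OF e f k(1) fe k(2) a(2)] k(4) by simp
    have "k (g c) = k c" using g_c k(5,6) k(7)[of "g c"] gc by (auto split: if_splits)
    then have kg: "idem_le S k g"
      using idem_le_cover[OF e g k(1) ge k(2) c(2)] k(4) by simp
    show ?thesis
      \<comment> \<open>The roles swap: f has already lost a, so passing from f to k loses
        c.\<close>
      by (rule result[OF k(1) kf kg k(3), of c a]) (use a c False k(4) in auto)
  next
    case True
    \<comment> \<open>Both maps fix every other point of e, so they can differ only in where they
      send a.\<close>
    have "f a \<noteq> g a"
    proof
      assume eq: "f a = g a"
      have "fibres S f = fibres S g"
      proof (rule fibres_cong)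
        fix s assume s: "s \<in> S"
        show "f s = g s"
        proof (cases "e s = a")
          case False
          then have "e s \<in> f ` S" "e s \<in> g ` S" using s a(2) c(2) True by auto
          then have "f (e s) = g (e s)" using idem_in_image[OF f, of "e s"] idem_in_image[OF g, of "e s"] by simp
          then show ?thesis using fe ge s by (simp add: idem_le_def)
        qed (use fe ge s eq in \<open>metis idem_le_def\<close>)
      qed
      with neq show False ..
    qed
    have hd: "h (f a) = h a" "h (g a) = h a" using fa(3) gc(3) True by auto
    \<comment> \<open>Here d is the one of \<open>f a\<close>, \<open>g a\<close> that h does not
      fix. Removing a and d and sending both to b merges a with \<open>f a\<close> and with
      \<open>g a\<close> at once.\<close>
    have step: ?thesis if b: "b \<in> e ` S" "b \<noteq> a" "h b = h a" and d: "d \<in> e ` S" "d \<noteq> a" "d \<notin> h ` S"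
      "h d = h a" and "b \<noteq> d" and fg: "{f a, g a} = {b, d}" for b d
    proof -
      have b': "b \<in> e ` S - {a, d}" "h b = h d" using b d \<open>b \<noteq> d\<close> by auto
      obtain k where k: "idem S k" "idem_le S k e" "idem_le S h k" "k ` S = e ` S - {a, d}"
        "k a = b" "k d = b" "\<And>p. p \<in> e ` S - {a, d} \<Longrightarrow> k p = p"
        using idem_kill_two[OF e h he a(1) d(1) d(2)[symmetric] ah d(3) b'(1) b(3) b'] by metis
      have kb: "k b = b" using k(7) b'(1) .
      have "f a \<in> {b, d}" "g a \<in> {b, d}" using fg by auto
      then have "k (f a) = k a" "k (g a) = k a" using k(5,6) kb by auto
      then have kf: "idem_le S k f" and kg: "idem_le S k g"
        using idem_le_cover[OF e f k(1) fe k(2) a(2)] idem_le_cover[OF e g k(1) ge k(2) c(2)]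
          k(4) True by simp_all
      show ?thesis
        by (rule result[OF k(1) kf kg k(3), of d d]) (use a c d True k(4) in auto)
    qed
    show ?thesis
    proof (cases "h (f a) = f a")
      case b_fixed: True
      have "g a \<notin> h ` S"
      proof
        assume "g a \<in> h ` S"
        then have "h (g a) = g a" using idem_in_image[OF h] by blast
        with b_fixed hd \<open>f a \<noteq> g a\<close> show False by simp
      qed
      then show ?thesis using step[of "f a" "g a"] fa gc hd \<open>f a \<noteq> g a\<close> True by simp
    next
      case False
      then have "f a \<notin> h ` S" using idem_in_image[OF h] by blast
      then show ?thesis using step[of "g a" "f a"] fa gc hd \<open>f a \<noteq> g a\<close> True by (simp add: insert_commute)
    qed
  qed
qed

section \<open>Total semimodularity of pointed partitions\<close>

lemma perm_poset_plus_simps [simp]: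
  "(None, None) \<in> perm_poset_plus S"
  "(Some X, None) \<notin> perm_poset_plus S"
  "(Some X, Some Y) \<in> perm_poset_plus S \<longleftrightarrow> (X, Y) \<in> perm_poset S"
  by (auto simp: perm_poset_plus_def add_least_def)

lemma perm_poset_plus_le_None [simp]: "(u, None) \<in> perm_poset_plus S \<longleftrightarrow> u = None"
  by (cases u) simp_all

lemma fibres_le_refl: "idem S f \<Longrightarrow> (fibres S f, fibres S f) \<in> perm_poset S"
  by (simp add: fibres_le_iff idem_le_refl)

lemma Field_perm_poset: "Field (perm_poset S) = pointed_partitions S"
proof
  show "Field (perm_poset S) \<subseteq> pointed_partitions S" by (auto simp: Field_def perm_poset_def)
  show "pointed_partitions S \<subseteq> Field (perm_poset S)"
  proof
    fix X assume "X \<in> pointed_partitions S"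
    then obtain f where "idem S f" "X = fibres S f" by (rule pointed_partition_eq_fibres)
    then show "X \<in> Field (perm_poset S)" using fibres_le_refl by (auto simp: Field_def)
  qed
qed

lemma None_le_fibres: "idem S f \<Longrightarrow> (None, Some (fibres S f)) \<in> perm_poset_plus S"
  using fibres_in_pointed_partitions
  by (auto simp: perm_poset_plus_def add_least_def Field_perm_poset)

lemma Field_perm_poset_plus:
  "Field (perm_poset_plus S) = insert None (Some ` pointed_partitions S)"
  unfolding Field_perm_poset[symmetric] perm_poset_plus_def add_least_def
  by (auto simp: Field_def)

lemma perm_poset_plus_cases:
  assumes "x \<in> Field (perm_poset_plus S)"
  obtains "x = None" | f where "idem S f" "x = Some (fibres S f)"
proof -
  from assms consider "x = None" | X where "X \<in> pointed_partitions S" "x = Some X"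
    unfolding Field_perm_poset_plus by blast
  then show thesis
  proof cases
    case (2 X)
    from 2(1) obtain f where "idem S f" "X = fibres S f" by (rule pointed_partition_eq_fibres)
    with 2(2) that(2) show thesis by simp
  qed (rule that(1))
qed

lemma fibres_le_cases:
  assumes "(u, Some (fibres S e)) \<in> perm_poset_plus S" "idem S e"
  obtains "u = None" | f where "idem S f" "idem_le S f e" "u = Some (fibres S f)"
proof -
  have "u \<in> Field (perm_poset_plus S)" using assms(1) by (auto simp: Field_def)
  then show ?thesis
    by (cases rule: perm_poset_plus_cases) (use assms that in \<open>auto simp: fibres_le_iff\<close>)
qed

lemma fibres_le_Some:
  assumes "(u, Some (fibres S e)) \<in> perm_poset_plus S" "idem S e" "u \<noteq> None"
  shows "\<exists>f. idem S f \<and> idem_le S f e \<and> u = Some (fibres S f)"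
  using assms(1,2) by (cases rule: fibres_le_cases) (use assms(3) in auto)

lemma fibres_eq_image: "fibres S f = fibres S g \<Longrightarrow> f ` S = g ` S"
  by (metis snd_fibres)

lemma fibres_eq_iff:
  assumes "idem S f" "idem S g" "idem_le S f g" "idem_le S g f"
  shows "fibres S f = fibres S g"
  using idem_le_eq[OF assms(1-3)] idem_le_image[OF assms(4,2)] .

lemma partial_order_perm_poset_plus: "Partial_order (perm_poset_plus S)"
proof -
  let ?Q = "perm_poset_plus S"
  have refl: "(x, x) \<in> ?Q" if "x \<in> Field ?Q" for x
    using that by (cases rule: perm_poset_plus_cases) (simp_all add: fibres_le_refl)
  have trans: "(x, z) \<in> ?Q" if "(x, y) \<in> ?Q" "(y, z) \<in> ?Q" for x y z
  proof -
    have "x \<in> Field ?Q" "y \<in> Field ?Q" "z \<in> Field ?Q" using that by (auto simp: Field_def)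
    note c = this[THEN perm_poset_plus_cases]
    show ?thesis
    proof (cases rule: c(3))
      case 1
      with that have "y = None" by (cases y) auto
      with that 1 show ?thesis by simp
    next
      case h: (2 h)
      show ?thesis
      proof (cases rule: c(1))
        case 1
        then show ?thesis using h None_le_fibres by simp
      next
        case f: (2 f)
        show ?thesis
        proof (cases rule: c(2))
          case 1
          then show ?thesis using that f by simp
        next
          case g: (2 g)
          then have "idem_le S f g" "idem_le S g h" using that f g h by (simp_all add: fibres_le_iff)
          then show ?thesis using f g h idem_le_trans by (simp add: fibres_le_iff)
        qed
      qed
    qed
  qed
  have antisym: "x = y" if "(x, y) \<in> ?Q" "(y, x) \<in> ?Q" for x y
  proof -
    have "x \<in> Field ?Q" "y \<in> Field ?Q" using that by (auto simp: Field_def)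
    note c = this[THEN perm_poset_plus_cases]
    show ?thesis
    proof (cases rule: c(1))
      case 1
      then show ?thesis using that by (cases y) auto
    next
      case f: (2 f)
      show ?thesis
      proof (cases rule: c(2))
        case 1
        then show ?thesis using that f by simp
      next
        case g: (2 g)
        then have "idem_le S f g" "idem_le S g f" using that f by (simp_all add: fibres_le_iff)
        then show ?thesis using f g fibres_eq_iff[of S f g] by simp
      qed
    qed
  qed
  have "refl_on (Field ?Q) ?Q" "trans ?Q" "antisym ?Q"
    using refl trans antisym by (simp_all only: refl_on_def trans_def antisym_def) blast+
  then show ?thesis
    by (auto simp: partial_order_on_def preorder_on_def Field_def)
qed

lemma bounded_perm_poset_plus: "bounded_poset ((perm_poset_plus S)\<inverse>)"
proof -
  let ?Q = "perm_poset_plus S"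
  let ?id = "Some (fibres S (\<lambda>s. s))"
  have id: "idem S (\<lambda>s. s)" by (simp add: idem_def)
  have "(None, x) \<in> ?Q \<and> (x, ?id) \<in> ?Q" if "x \<in> Field ?Q" for x
    using that
  proof (cases rule: perm_poset_plus_cases)
    case (2 f)
    then have "idem_le S f (\<lambda>s. s)" by (simp add: idem_le_def)
    with 2 id show ?thesis by (simp add: None_le_fibres fibres_le_iff)
  qed (use id in \<open>simp add: None_le_fibres\<close>)
  moreover have "None \<in> Field ?Q" "?id \<in> Field ?Q"
    using fibres_in_pointed_partitions[OF id] by (simp_all add: Field_perm_poset_plus)
  ultimately show ?thesis
    using partial_order_perm_poset_plus unfolding bounded_poset_def
    by (simp only: partial_order_on_converse Field_converse converse_iff) blast
qed

lemma finite_perm_poset_plus: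
  assumes "finite S"
  shows "finite (Field (perm_poset_plus S))"
proof -
  have "pointed_partitions S \<subseteq> Pow (Pow S \<times> S)"
  proof
    fix X assume "X \<in> pointed_partitions S"
    then obtain f where "idem S f" "X = fibres S f" by (rule pointed_partition_eq_fibres)
    then show "X \<in> Pow (Pow S \<times> S)" by (auto simp: fibres_def idem_def)
  qed
  then have "finite (pointed_partitions S)"
    by (rule finite_subset) (simp add: assms)
  then show ?thesis by (simp add: Field_perm_poset_plus)
qed

section \<open>Covers recognised by sets of points\<close>

definition points :: "('a set \<times> 'a) set option \<Rightarrow> 'a set" where
  "points x = (case x of None \<Rightarrow> {} | Some X \<Rightarrow> snd ` X)"

lemma points_simps [simp]: "points None = {}" "points (Some (fibres S f)) = f ` S"
  by (simp_all add: points_def)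

lemma points_eq_empty:
  assumes "S \<noteq> {}" "w \<in> Field (perm_poset_plus S)" "points w = {}"
  shows "w = None"
  using assms(2) by (cases rule: perm_poset_plus_cases) (use assms(1,3) in auto)

text \<open>A nonempty S has at least one point in every pointed partition, which separates it from
  the added least element. For empty S the empty partition would have no points either.\<close>

lemma points_strict_mono:
  assumes "S \<noteq> {}" "poset_less (perm_poset_plus S) u x"
  shows "points u \<subset> points x"
proof -
  have "x \<in> Field (perm_poset_plus S)" using assms(2) by (auto simp: poset_less_def Field_def)
  then show ?thesis
  proof (cases rule: perm_poset_plus_cases)
    case 1
    then show ?thesis using assms(2) by (cases u) (auto simp: poset_less_def)
  next
    case (2 g)
    then have "(u, Some (fibres S g)) \<in> perm_poset_plus S" "idem S g"
      using assms(2) by (simp_all add: poset_less_def)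
    then show ?thesis
    proof (cases rule: fibres_le_cases)
      case 1
      then show ?thesis using 2 assms(1) by auto
    next
      case f: (2 f)
      then have "fibres S f \<noteq> fibres S g" using assms(2) 2 by (auto simp: poset_less_def)
      then have "\<not> g ` S \<subseteq> f ` S" using idem_le_eq f 2 by blast
      then show ?thesis using idem_le_image[OF f(2,1)] f 2 by auto
    qed
  qed
qed

text \<open>Strictly between two sets that differ by one element there is no room for the points of
  a third.\<close>

lemma covered_byI_points:
  assumes "S \<noteq> {}" "(u, x) \<in> perm_poset_plus S" "a \<in> points x" "points u = points x - {a}"
  shows "covered_by (perm_poset_plus S) u x"
  unfolding covered_by_def
proof
  show "poset_less (perm_poset_plus S) u x" using assms(2-4) by (auto simp: poset_less_def)
  show "\<not> (\<exists>z. poset_less (perm_poset_plus S) u z \<and> poset_less (perm_poset_plus S) z x)"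
  proof
    assume "\<exists>z. poset_less (perm_poset_plus S) u z \<and> poset_less (perm_poset_plus S) z x"
    then obtain z where "poset_less (perm_poset_plus S) u z" "poset_less (perm_poset_plus S) z x"
      by blast
    from this[THEN points_strict_mono[OF assms(1)]] assms(4) show False by blast
  qed
qed

text \<open>Some point a of e is lost in f. Sending only a to \<open>f a\<close> loses one point and
  stays above f, as f does not distinguish a from \<open>f a\<close>.\<close>

lemma idem_coatom_above:
  assumes e: "idem S e" and f: "idem S f" and fe: "idem_le S f e"
    and neq: "fibres S f \<noteq> fibres S e"
  obtains w a where "idem S w" "idem_le S w e" "idem_le S f w" "a \<in> e ` S" "w ` S = e ` S - {a}"
proof -
  obtain a where a: "a \<in> e ` S" "a \<notin> f ` S" using idem_le_eq[OF f e fe] neq by blast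
  have aS: "a \<in> S" and ea: "e a = a" using idem_in_image[OF e a(1)] by auto
  have "f a \<in> f ` S" using aS by (rule imageI)
  then have b: "f a \<in> e ` S" "f a \<noteq> a"
    using idem_le_image[OF fe f] a(2) by auto
  let ?w = "\<lambda>s. if e s = a then f a else e s"
  have fix_w: "?w p = p" if "p \<in> e ` S - {a}" for p
    using that idem_in_image[OF e, of p] by auto
  have w_in: "?w s \<in> e ` S - {a}" if "s \<in> S" for s using that b by auto
  show thesis
  proof (rule that[of ?w a])
    show "idem S ?w" unfolding idem_def
    proof (intro ballI conjI)
      fix s assume s: "s \<in> S"
      show "?w s \<in> S" using DiffD1[OF w_in[OF s]] idem_in_image[OF e] by fast
      show "?w (?w s) = ?w s" by (rule fix_w[OF w_in[OF s]])
    qed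
    show "idem_le S ?w e" unfolding idem_le_def
    proof (intro ballI conjI)
      fix s assume s: "s \<in> S"
      show "?w (e s) = ?w s" using e s by (simp add: idem_def)
      show "e (?w s) = ?w s" using DiffD1[OF w_in[OF s]] idem_in_image[OF e] by fast
    qed
    show "idem_le S f ?w" unfolding idem_le_def
    proof (intro ballI conjI)
      fix s assume s: "s \<in> S"
      have "f (e s) = f s" "e (f s) = f s" "f (f a) = f a"
        using fe f s aS by (auto simp: idem_le_def idem_def)
      moreover have "f s \<noteq> a" using s a(2) by blast
      ultimately show "f (?w s) = f s" "?w (f s) = f s" by auto
    qed
    show "?w ` S = e ` S - {a}"
    proof
      show "?w ` S \<subseteq> e ` S - {a}" by (rule image_subsetI) (rule w_in)
      show "e ` S - {a} \<subseteq> ?w ` S"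
      proof
        fix p assume p: "p \<in> e ` S - {a}"
        then have "p \<in> S" using idem_in_image[OF e] by fast
        then show "p \<in> ?w ` S" using fix_w[OF p] by (intro image_eqI[of _ _ p]) simp_all
      qed
    qed
  qed (rule a(1))
qed

lemma covered_byD_points:
  assumes "S \<noteq> {}" "idem S e" "covered_by (perm_poset_plus S) u (Some (fibres S e))"
  obtains a where "a \<in> e ` S" "points u = e ` S - {a}"
proof -
  let ?Q = "perm_poset_plus S"
  have le: "(u, Some (fibres S e)) \<in> ?Q" and neq: "u \<noteq> Some (fibres S e)"
    and between: "\<And>w. (u, w) \<in> ?Q \<Longrightarrow> (w, Some (fibres S e)) \<in> ?Q \<Longrightarrow> w = u \<or> w = Some (fibres S e)"
    using assms(3) by (auto simp: covered_by_def poset_less_def)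
  from le assms(2) show thesis
  proof (cases rule: fibres_le_cases)
    case 1
    \<comment> \<open>The constant map to a point of e lies strictly above \<open>None\<close> and
      below e, so it must give the same partition as e, and e has a single point.\<close>
    obtain a where a: "a \<in> e ` S" using assms(1) by blast
    then have aS: "a \<in> S" "e a = a" using idem_in_image[OF assms(2) a] by auto
    let ?f = "\<lambda>s. a"
    have f: "idem S ?f" "idem_le S ?f e" using aS by (auto simp: idem_def idem_le_def)
    then have "(u, Some (fibres S ?f)) \<in> ?Q" "(Some (fibres S ?f), Some (fibres S e)) \<in> ?Q"
      using assms(2) 1 by (simp_all add: None_le_fibres fibres_le_iff)
    then have "Some (fibres S ?f) = u \<or> Some (fibres S ?f) = Some (fibres S e)"
      by (rule between)
    with 1 have "fibres S ?f = fibres S e" by simp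
    then have "e ` S = {a}" using fibres_eq_image[of S ?f e] assms(1) by auto
    with that[of a] 1 show thesis by simp
  next
    case (2 f)
    then have fe: "fibres S f \<noteq> fibres S e" using neq by simp
    obtain w a where w: "idem S w" "idem_le S w e" "idem_le S f w" "a \<in> e ` S" "w ` S = e ` S - {a}"
      using idem_coatom_above[OF assms(2) 2(1,2) fe] .
    have "(u, Some (fibres S w)) \<in> ?Q" "(Some (fibres S w), Some (fibres S e)) \<in> ?Q"
      using w 2 assms(2) by (simp_all add: fibres_le_iff)
    from between[OF this] have "Some (fibres S w) = u \<or> fibres S w = fibres S e" by simp
    moreover have "fibres S w \<noteq> fibres S e" using w(4,5) fibres_eq_image[of S w e] by blast
    ultimately have "u = Some (fibres S w)" by simp
    with that w(4,5) show thesis by simp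
  qed
qed

lemma perm_poset_plus_diamond:
  assumes S: "S \<noteq> {}" and neq: "u \<noteq> v"
    and ux: "covered_by (perm_poset_plus S) u x" and vx: "covered_by (perm_poset_plus S) v x"
    and yu: "(y, u) \<in> perm_poset_plus S" and yv: "(y, v) \<in> perm_poset_plus S"
  shows "\<exists>z. (y, z) \<in> perm_poset_plus S \<and>
    covered_by (perm_poset_plus S) z u \<and> covered_by (perm_poset_plus S) z v"
proof -
  let ?Q = "perm_poset_plus S"
  have ux': "(u, x) \<in> ?Q" "u \<noteq> x" and vx': "(v, x) \<in> ?Q" "v \<noteq> x"
    using ux vx by (auto simp: covered_by_def poset_less_def)
  have "x \<in> Field ?Q" using ux' by (auto simp: Field_def)
  moreover have "x \<noteq> None"
  proof
    assume "x = None"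
    with ux' show False by simp
  qed
  ultimately obtain e where e: "idem S e" and x: "x = Some (fibres S e)"
    by (cases rule: perm_poset_plus_cases) auto
  obtain a where a: "a \<in> e ` S" "points u = e ` S - {a}"
    using covered_byD_points[OF S e ux[unfolded x]] .
  obtain c where c: "c \<in> e ` S" "points v = e ` S - {c}"
    using covered_byD_points[OF S e vx[unfolded x]] .
  have "u \<in> Field ?Q" "v \<in> Field ?Q" using ux' vx' by (auto simp: Field_def)
  \<comment> \<open>Both lower covers have one point fewer than x, so if one is the least element,
    so is the other. Being distinct, neither is.\<close>
  then have "u = None \<longleftrightarrow> points u = {}" "v = None \<longleftrightarrow> points v = {}"
    using points_eq_empty[OF S] by auto
  moreover have "M - {a} = {} \<longleftrightarrow> M - {c} = {}" if "a \<in> M" "c \<in> M" for M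
    using that by blast
  ultimately have "u = None \<longleftrightarrow> v = None"
    using a c by simp
  with neq have "u \<noteq> None" "v \<noteq> None" by auto
  obtain f where f: "idem S f" "idem_le S f e" and u: "u = Some (fibres S f)"
    using fibres_le_Some[OF ux'(1)[unfolded x] e \<open>u \<noteq> None\<close>] by blast
  obtain g where g: "idem S g" "idem_le S g e" and v: "v = Some (fibres S g)"
    using fibres_le_Some[OF vx'(1)[unfolded x] e \<open>v \<noteq> None\<close>] by blast
  have fS: "f ` S = e ` S - {a}" and gS: "g ` S = e ` S - {c}" using a c u v by simp_all
  have fg: "fibres S f \<noteq> fibres S g" using neq u v by simp
  have diamond: ?thesis if h: "idem S h" "idem_le S h f" "idem_le S h g"
    and y: "(y, Some (fibres S h)) \<in> ?Q" for h
  proof -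
    obtain k p q where k: "idem S k" "idem_le S k f" "idem_le S k g" "idem_le S h k"
      and p: "p \<in> f ` S" "k ` S = f ` S - {p}" and q: "q \<in> g ` S" "k ` S = g ` S - {q}"
      using idem_semimodular[OF e f(1) g(1) h(1) f(2) g(2) h(2,3) a(1) fS c(1) gS fg] .
    let ?z = "Some (fibres S k)"
    have "(Some (fibres S h), ?z) \<in> ?Q" "(?z, u) \<in> ?Q" "(?z, v) \<in> ?Q"
      using u v h k f g by (simp_all add: fibres_le_iff)
    moreover have "(y, ?z) \<in> ?Q"
      using poset_trans[OF partial_order_perm_poset_plus y calculation(1)] .
    moreover have "covered_by ?Q ?z u"
      using covered_byI_points[OF S calculation(2), of p] u p by simp
    moreover have "covered_by ?Q ?z v"
      using covered_byI_points[OF S calculation(3), of q] v q by simp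
    ultimately show ?thesis by blast
  qed
  have "y \<in> Field ?Q" using yu by (auto simp: Field_def)
  then show ?thesis
  proof (cases rule: perm_poset_plus_cases)
    case (2 h)
    then show ?thesis
      using diamond[of h] yu yv u v f g by (simp add: fibres_le_iff idem_le_refl)
  next
    case 1
    show ?thesis
    \<comment> \<open>With only the two points a and c, the covers have one point each and their
      common lower cover is the least element. Otherwise a point t shared by f and g gives a
      constant map below both, which serves as h.\<close>
    proof (cases "e ` S \<subseteq> {a, c}")
      case True
      have "f ` S \<noteq> {}" using S by simp
      moreover have "g ` S \<noteq> {}" using S by simp
      ultimately have "f ` S = {c}" "g ` S = {a}" using True unfolding fS gS by blast+
      then have "covered_by ?Q None u" "covered_by ?Q None v"
        using covered_byI_points[OF S None_le_fibres[OF f(1)], of c]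
          covered_byI_points[OF S None_le_fibres[OF g(1)], of a] u v by simp_all
      with 1 show ?thesis by (intro exI[of _ None]) simp
    next
      case False
      then obtain t where t: "t \<in> f ` S" "t \<in> g ` S" using fS gS by blast
      then have "t \<in> S" "f t = t" "g t = t"
        using idem_in_image[OF f(1) t(1)] idem_in_image[OF g(1) t(2)] by auto
      then have h: "idem S (\<lambda>_. t)" "idem_le S (\<lambda>_. t) f" "idem_le S (\<lambda>_. t) g"
        by (auto simp: idem_def idem_le_def)
      with diamond[OF h] 1 show ?thesis by (simp add: None_le_fibres)
    qed
  qed
qed

theorem totally_semimodular_perm_poset_plus:
  assumes "finite S" "S \<noteq> {}"
  shows "totally_semimodular ((perm_poset_plus S)\<inverse>)"
  unfolding totally_semimodular_def
proof (intro conjI allI impI ballI)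
  fix x y u v
  assume "u \<in> poset_interval ((perm_poset_plus S)\<inverse>) x y" "v \<in> poset_interval ((perm_poset_plus S)\<inverse>) x y"
    and uv: "u \<noteq> v \<and> covered_by ((perm_poset_plus S)\<inverse>) x u \<and> covered_by ((perm_poset_plus S)\<inverse>) x v"
  then have le: "(u, x) \<in> perm_poset_plus S" "(y, u) \<in> perm_poset_plus S" "(y, v) \<in> perm_poset_plus S"
    by (auto simp: poset_interval_def)
  obtain z where z: "(y, z) \<in> perm_poset_plus S" "covered_by (perm_poset_plus S) z u"
    "covered_by (perm_poset_plus S) z v"
    using perm_poset_plus_diamond[OF assms(2) _ _ _ le(2,3)] uv by auto
  have "(z, u) \<in> perm_poset_plus S" using z(2) by (simp add: covered_by_def poset_less_def)
  with le(1) have "(z, x) \<in> perm_poset_plus S"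
    using poset_trans[OF partial_order_perm_poset_plus] by blast
  with z show "\<exists>z\<in>poset_interval ((perm_poset_plus S)\<inverse>) x y.
      covered_by ((perm_poset_plus S)\<inverse>) u z \<and> covered_by ((perm_poset_plus S)\<inverse>) v z"
    by (intro bexI[of _ z]) (auto simp: poset_interval_def)
qed (use finite_perm_poset_plus[OF assms(1)] bounded_perm_poset_plus in simp_all)

theorem proposition4p17:
  fixes S :: "'a set"
  assumes "finite S" and "S \<noteq> {}"
  shows "totally_semimodular ((perm_poset_plus S)\<inverse>) \<and>
         cohen_macaulay TYPE('k::comm_ring_1) (perm_poset_plus S)"
  using totally_semimodular_perm_poset_plus[OF assms] cohen_macaulay_totally_semimodular_converse
  by blast

end
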